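(* Assume $\mathfrak{p}=\mathfrak{c}$. Then there exist a compact space $K$, a strictly positive measure $\mu$ on $K$ which is not countably determined, and a continuous mapping $f\colon K\to 2^\omega$ such that for every $t\in 2^\omega$ the fiber $f^{-1}[\{t\}]$ is homeomorphic to an ordinal number (with the order topology); so, in particular, there is no continuous surjection from $K$ onto $[0,1]^{\omega_1}$.
   Context: $\mathfrak{c}=2^{\aleph_0}$. The assertion $\mathfrak{p}=\mathfrak{c}$ says: every family $\mathcal{A}$ of subsets of $\omega$ with $|\mathcal{A}|<\mathfrak{c}$ such that every finite intersection of elements of $\mathcal{A}$ is infinite has an infinite pseudo-intersection, i.e. an infinite $P\subseteq\omega$ such that $P\setminus A$ is finite for each $A\in\mathcal{A}$. Compact spaces are Hausdorff. A measure on a topological space is a finite Borel measure that is Radon, i.e. inner regular with respect to compact sets. A measure $\mu$ on $K$ is strictly positive (equivalently, $K$ supports $\mu$) if $\mu(U)>0$ for every nonempty open $U\subseteq K$. A measure $\mu$ on $K$ is countably determined if there is a countable family $\mathcal{F}$ of closed subsets of $K$ such that $\mu(U)=\sup\{\mu(F)\colon F\in\mathcal{F},\ F\subseteq U\}$ for every open $U\subseteq K$. An empty fiber is regarded as the ordinal $0$. *)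

theory Defs
  imports "HOL-Analysis.Analysis"
begin

(* p = c.  Here (UNIV :: nat set set) is the power set of omega, so \<prec> compares with 2^aleph_0.
   The empty intersection is UNIV, which is infinite, so the empty subfamily imposes nothing. *)
definition p_eq_c :: bool where
  "p_eq_c \<longleftrightarrow>
     (\<forall>\<A> :: nat set set.
        \<A> \<prec> (UNIV :: nat set set) \<and>
        (\<forall>\<F>. finite \<F> \<and> \<F> \<subseteq> \<A> \<longrightarrow> infinite (\<Inter>\<F>)) \<longrightarrow>
        (\<exists>P :: nat set. infinite P \<and> (\<forall>A\<in>\<A>. finite (P - A))))"

definition radon_measure_on :: "'a topology \<Rightarrow> 'a measure \<Rightarrow> bool" where
  "radon_measure_on K \<mu> \<longleftrightarrow>
     space \<mu> = topspace K \<and>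
     sets \<mu> = sigma_sets (topspace K) {U. openin K U} \<and>
     finite_measure \<mu> \<and>
     (\<forall>B\<in>sets \<mu>. emeasure \<mu> B = (SUP C\<in>{C. compactin K C \<and> C \<subseteq> B}. emeasure \<mu> C))"

definition strictly_positive_on :: "'a topology \<Rightarrow> 'a measure \<Rightarrow> bool" where
  "strictly_positive_on K \<mu> \<longleftrightarrow> (\<forall>U. openin K U \<and> U \<noteq> {} \<longrightarrow> emeasure \<mu> U > 0)"

(* The supremum of no values is 0 in ennreal. *)
definition countably_determined :: "'a topology \<Rightarrow> 'a measure \<Rightarrow> bool" where
  "countably_determined K \<mu> \<longleftrightarrow>
     (\<exists>\<F>. countable \<F> \<and> (\<forall>F\<in>\<F>. closedin K F) \<and>
        (\<forall>U. openin K U \<longrightarrow> emeasure \<mu> U = (SUP F\<in>{F \<in> \<F>. F \<subseteq> U}. emeasure \<mu> F)))"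

definition cantor_space :: "(nat \<Rightarrow> bool) topology" where
  "cantor_space = product_topology (\<lambda>_. discrete_topology UNIV) UNIV"

(* The order topology of a (reflexive) linear order r on Field r, generated by the open rays.
   Field r itself is included for the one-point order, whose open rays are empty. *)
definition order_topology_of :: "'a rel \<Rightarrow> 'a topology" where
  "order_topology_of r =
     topology_generated_by
       (insert (Field r) (underS r ` Field r \<union> aboveS r ` Field r))"

(* Ordinals are represented by well-orders.  Taking r on the type of the points of X loses no
   generality: a well-order on any set in bijection with topspace X can be transported.
   The ordinal 0 is r = {}. *)
definition homeomorphic_to_ordinal :: "'a topology \<Rightarrow> bool" where
  "homeomorphic_to_ordinal X \<longleftrightarrow>
     (\<exists>r :: 'a rel. Well_order r \<and> X homeomorphic_space order_topology_of r)"

(* [0,1]^omega_1: cardSuc natLeq is the successor cardinal of omega, as a well-order of type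
   omega_1; its field indexes the factors. *)
definition tychonoff_cube_omega1 :: "(nat set \<Rightarrow> real) topology" where
  "tychonoff_cube_omega1 =
     product_topology (\<lambda>_. top_of_set {0..1}) (Field (cardSuc natLeq))"

end

theory Submission
  imports Defs "HOL-Probability.Probability" "HOL-Library.Countable_Set_Type"
begin

text \<open>Let \<open>\<lambda>\<close> be the product on \<open>nat \<Rightarrow> nat\<close> of geometric distributions with parameter \<open>1/2\<close>.
  The box \<open>{x. \<forall>k. x k \<le> h k}\<close> has positive measure iff \<open>(\<Sum>k. 2 powr - h k) < \<infinity>\<close>; call such
  \<open>h\<close> thin. Countably many thin functions have a thin eventual lower bound, but no thin function is an
  eventual lower bound of all thin ones. A greedy recursion along a well-order of \<open>nat \<Rightarrow> nat\<close> gives a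
  family \<open>C\<close> of thin functions that is eventually decreasing along the well-order and has no thin
  eventual lower bound. Let \<open>K\<close> be the Stone space of the algebra generated by the cylinders and the
  boxes of members of \<open>C\<close>, with the Radon measure that extends \<open>\<lambda>\<close>, and let \<open>f\<close> restrict an
  ultrafilter to the cylinders.

  Near a point \<open>x\<close> the boxes containing \<open>x\<close> decrease along the well-order, so an ultrafilter in the
  fibre over \<open>x\<close> is an initial segment of a well-ordered set, and the fibre is a compact ordinal.
  Every closed set of positive measure inside the box of some \<open>h \<in> C\<close> lies in a box of a least function,
  which is thin and at most \<open>h\<close>. A countable family determining the measure would hence yield
  countably many thin functions such that each \<open>h \<in> C\<close> is above one of them; a thin eventual lower
  bound of these is one of \<open>C\<close>, a contradiction.

  If \<open>K\<close> mapped onto \<open>[0,1]\<close> to the power \<open>\<omega>\<^sub>1\<close>, then by deciding the binary digits of \<open>f\<close> one at a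
  time, fixing finitely many coordinates of the cube at each step, some fibre would map onto \<open>[0,1]\<close>;
  but a continuous real function on a compact ordinal has countable range.\<close>

section \<open>Radon extensions of clopen contents\<close>

text \<open>By compactness of \<open>S\<close>, finitely many of the clopen subsets of
  \<open>U\<close> already cover it.\<close>

lemma clopen_between:
  assumes K: "compact_space K"
    and base: "\<And>U x. openin K U \<Longrightarrow> x \<in> U \<Longrightarrow> \<exists>C. openin K C \<and> closedin K C \<and> x \<in> C \<and> C \<subseteq> U"
    and S: "closedin K S" and U: "openin K U" and SU: "S \<subseteq> U"
  obtains C where "openin K C" "closedin K C" "S \<subseteq> C" "C \<subseteq> U"
proof -
  let ?\<U> = "{C. openin K C \<and> closedin K C \<and> C \<subseteq> U}"
  have "compactin K S" using K S by (rule closedin_compact_space)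
  moreover have "S \<subseteq> \<Union>?\<U>"
    using base[OF U] SU by blast
  ultimately obtain \<F> where \<F>: "finite \<F>" "\<F> \<subseteq> ?\<U>" "S \<subseteq> \<Union>\<F>"
    unfolding compactin_def by (metis (no_types, lifting) mem_Collect_eq)
  show thesis
  proof
    show "openin K (\<Union>\<F>)" "closedin K (\<Union>\<F>)" "S \<subseteq> \<Union>\<F>" "\<Union>\<F> \<subseteq> U"
      using \<F> by (auto intro!: openin_Union closedin_Union)
  qed
qed

text \<open>Caratheodory's construction: \<open>inn\<close> extends \<open>m\<close> to open sets
  from inside, \<open>out\<close> extends \<open>inn\<close> to all sets from outside. The clopen
  base makes \<open>inn\<close> subadditive, and compactness of clopen sets raises this to countable
  subadditivity.\<close>

proposition radon_measure_extending_clopen_content: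
  fixes K :: "'a topology" and m :: "'a set \<Rightarrow> ennreal"
  assumes K: "compact_space K"
    and base: "\<And>U x. openin K U \<Longrightarrow> x \<in> U \<Longrightarrow> \<exists>C. openin K C \<and> closedin K C \<and> x \<in> C \<and> C \<subseteq> U"
    and m_empty: "m {} = 0"
    and m_Un: "\<And>A B. openin K A \<Longrightarrow> closedin K A \<Longrightarrow> openin K B \<Longrightarrow> closedin K B \<Longrightarrow> A \<inter> B = {}
                 \<Longrightarrow> m (A \<union> B) = m A + m B"
    and m_fin: "m (topspace K) \<noteq> \<infinity>"
  obtains \<mu> where "radon_measure_on K \<mu>"
    and "\<And>C. openin K C \<Longrightarrow> closedin K C \<Longrightarrow> emeasure \<mu> C = m C"
proof -
  define clop where "clop C \<longleftrightarrow> openin K C \<and> closedin K C" for C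
  define inn where "inn U = (SUP C\<in>{C. clop C \<and> C \<subseteq> U}. m C)" for U
  define out where "out E = (INF U\<in>{U. openin K U \<and> E \<subseteq> U}. inn U)" for E
  let ?X = "topspace K"
  have lt_plus: "a < a + ennreal e" if "a < \<infinity>" "0 < e" for a e
    using that ennreal_add_left_cancel_less[of a 0 "ennreal e"] by simp
  have clop_sub: "C \<subseteq> ?X" if "clop C" for C
    using that by (auto simp: clop_def dest: openin_subset)
  have clop_empty [simp]: "clop {}" and clop_top [simp]: "clop ?X"
    by (auto simp: clop_def)
  have clop_Un: "clop (A \<union> B)" and clop_Int: "clop (A \<inter> B)" and clop_Diff: "clop (A - B)"
    if "clop A" "clop B" for A B
    using that by (auto simp: clop_def openin_diff closedin_diff)
  have m_split: "m A = m (A \<inter> B) + m (A - B)" if "clop A" "clop B" for A B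
  proof -
    have "m ((A \<inter> B) \<union> (A - B)) = m (A \<inter> B) + m (A - B)"
      using clop_Int[OF that] clop_Diff[OF that] by (intro m_Un) (auto simp: clop_def)
    then show ?thesis by (simp add: Int_Diff_Un)
  qed
  have m_mono: "m A \<le> m B" if "clop A" "clop B" "A \<subseteq> B" for A B
    using m_split[OF that(2,1)] that(3) by (simp add: Int_absorb1)
  have inn_mono: "inn U \<le> inn V" if "U \<subseteq> V" for U V
    unfolding inn_def using that by (intro SUP_subset_mono) auto
  have m_le_inn: "m C \<le> inn U" if "clop C" "C \<subseteq> U" for C U
    unfolding inn_def using that by (intro SUP_upper) auto
  have inn_clop: "inn C = m C" if "clop C" for C
    using that by (intro antisym m_le_inn) (auto simp: inn_def intro!: SUP_least m_mono)
  have inn_empty: "inn {} = 0"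
    using inn_clop[OF clop_empty] m_empty by simp
  have inn_Un: "inn (U \<union> V) \<le> inn U + inn V" if UV: "openin K U" "openin K V" for U V
    unfolding inn_def[of "U \<union> V"]
  proof (intro SUP_least)
    fix C assume "C \<in> {C. clop C \<and> C \<subseteq> U \<union> V}"
    then have C: "clop C" "C \<subseteq> U \<union> V" by auto
    \<comment> \<open>A clopen \<open>A\<close> between the closed set \<open>C - V\<close> and
      \<open>U\<close> cuts \<open>C\<close> into a clopen piece inside \<open>U\<close> and one
      inside \<open>V\<close>.\<close>
    have "closedin K (C - V)" "C - V \<subseteq> U"
      using C UV by (auto simp: clop_def)
    then obtain A where A: "openin K A" "closedin K A" "C - V \<subseteq> A" "A \<subseteq> U"
      using clopen_between[OF K base _ UV(1)] by blast
    then have "clop A" by (simp add: clop_def)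
    have "m C = m (C \<inter> A) + m (C - A)" using C \<open>clop A\<close> by (intro m_split)
    also have "\<dots> \<le> inn U + inn V"
      using A C \<open>clop A\<close> by (intro add_mono m_le_inn clop_Int clop_Diff) auto
    finally show "m C \<le> inn U + inn V" .
  qed
  have inn_UN: "inn (\<Union>n. U n) \<le> (\<Sum>n. inn (U n))" if U: "\<And>n::nat. openin K (U n)" for U
    unfolding inn_def[of "\<Union>n. U n"]
  proof (intro SUP_least)
    fix C assume "C \<in> {C. clop C \<and> C \<subseteq> (\<Union>n. U n)}"
    then have C: "clop C" "C \<subseteq> (\<Union>n. U n)" by auto
    have "compactin K C" using C K by (auto simp: clop_def intro: closedin_compact_space)
    then obtain \<F> where \<F>: "finite \<F>" "\<F> \<subseteq> range U" "C \<subseteq> \<Union>\<F>"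
      using C(2) U unfolding compactin_def by (metis (no_types, lifting) imageE)
    then obtain N where N: "finite N" "\<F> = U ` N"
      by (meson finite_subset_image)
    then obtain k where k: "N \<subseteq> {..<k}"
      by (meson finite_nat_iff_bounded)
    have fin: "inn (\<Union>n<j. U n) \<le> (\<Sum>n<j. inn (U n))" for j
    proof (induction j)
      case 0 then show ?case by (simp add: inn_empty)
    next
      case (Suc j)
      have "inn (\<Union>n<Suc j. U n) \<le> inn (\<Union>n<j. U n) + inn (U j)"
        using inn_Un[of "\<Union>n<j. U n" "U j"] U by (simp add: lessThan_Suc Un_commute openin_clauses(3))
      also have "\<dots> \<le> (\<Sum>n<Suc j. inn (U n))"
        using Suc.IH by (simp add: add_right_mono)
      finally show ?case .
    qed
    have "m C \<le> inn (\<Union>n<k. U n)"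
      using C \<F> N k by (intro m_le_inn) blast+
    also have "\<dots> \<le> (\<Sum>n<k. inn (U n))" by (rule fin)
    also have "\<dots> \<le> (\<Sum>n. inn (U n))" by (intro sum_le_suminf) auto
    finally show "m C \<le> (\<Sum>n. inn (U n))" .
  qed
  have out_mono: "out E \<le> out F" if "E \<subseteq> F" for E F
    unfolding out_def using that by (intro INF_superset_mono) auto
  have out_le: "out E \<le> inn U" if "openin K U" "E \<subseteq> U" for E U
    unfolding out_def using that by (intro INF_lower) auto
  have out_open: "out U = inn U" if "openin K U" for U
    using that by (intro antisym out_le) (auto simp: out_def intro!: INF_greatest inn_mono)
  have out_fin: "out E < \<infinity>" if "E \<subseteq> ?X" for E
  proof -
    have "out E \<le> inn ?X" using that by (intro out_le) auto
    also have "\<dots> < \<infinity>" using m_fin by (simp add: inn_clop top.not_eq_extremum)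
    finally show ?thesis .
  qed
  have out_UN: "out (\<Union>n. E n) \<le> (\<Sum>n. out (E n))" if E: "\<And>n::nat. E n \<subseteq> ?X" for E
  proof (rule ennreal_le_epsilon)
    fix e :: real assume "0 < e"
    have "\<exists>U. openin K U \<and> E n \<subseteq> U \<and> inn U \<le> out (E n) + ennreal (e * (1/2)^Suc n)" for n
    proof -
      have "out (E n) < out (E n) + ennreal (e * (1/2)^Suc n)"
        using out_fin[OF E[of n]] \<open>0 < e\<close> by (intro lt_plus) auto
      then obtain U where "openin K U" "E n \<subseteq> U" "inn U < out (E n) + ennreal (e * (1/2)^Suc n)"
        unfolding out_def[of "E n"] by (auto simp: INF_less_iff)
      then show ?thesis by (auto intro: less_imp_le)
    qed
    then obtain U where U: "\<And>n. openin K (U n)" "\<And>n. E n \<subseteq> U n"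
      "\<And>n. inn (U n) \<le> out (E n) + ennreal (e * (1/2)^Suc n)"
      by metis
    have "out (\<Union>n. E n) \<le> inn (\<Union>n. U n)"
      using U by (intro out_le) (auto intro: openin_clauses(3))
    also have "\<dots> \<le> (\<Sum>n. inn (U n))" using U by (intro inn_UN)
    also have "\<dots> \<le> (\<Sum>n. out (E n) + ennreal (e * (1/2)^Suc n))"
      using U by (intro suminf_le) auto
    also have "\<dots> = (\<Sum>n. out (E n)) + (\<Sum>n. ennreal (e * (1/2)^Suc n))"
      by (intro suminf_add[symmetric]) auto
    also have "(\<Sum>n. ennreal (e * (1/2)^Suc n)) = ennreal e"
      using sums_mult[OF power_half_series, of e] \<open>0 < e\<close>
      by (intro suminf_ennreal_eq) auto
    finally show "out (\<Union>n. E n) \<le> (\<Sum>n. out (E n)) + ennreal e" .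
  qed
  interpret PX: sigma_algebra ?X "Pow ?X" by (rule sigma_algebra_Pow)
  have oms: "outer_measure_space (Pow ?X) out"
    unfolding outer_measure_space_def
  proof (intro conjI)
    show "positive (Pow ?X) out"
      by (simp add: positive_def out_open inn_empty)
    show "increasing (Pow ?X) out"
      by (simp add: increasing_def out_mono)
    show "countably_subadditive (Pow ?X) out"
      unfolding countably_subadditive_def using out_UN by (meson PowD range_subsetD)
  qed
  have open_lambda: "U \<in> lambda_system ?X (Pow ?X) out" if U: "openin K U" for U
    unfolding PX.lambda_system_eq
  proof (safe intro!: antisym)
    show "x \<in> ?X" if "x \<in> U" for x using U that openin_subset by blast
    fix E assume E: "E \<subseteq> ?X"
    \<comment> \<open>Binary subadditivity, read off from the countable one by padding with empty
      sets.\<close>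
    have "out E \<le> out (\<Union>n::nat. if n = 0 then E \<inter> U else if n = 1 then E - U else {})"
      by (rule out_mono) (auto split: if_splits intro: exI[of _ 0] exI[of _ "Suc 0"])
    also have "\<dots> \<le> (\<Sum>n::nat. out (if n = 0 then E \<inter> U else if n = 1 then E - U else {}))"
      using E by (intro out_UN) auto
    also have "\<dots> = (\<Sum>n\<in>{0, 1::nat}. out (if n = 0 then E \<inter> U else if n = 1 then E - U else {}))"
      by (intro suminf_finite) (auto simp: out_open inn_empty)
    also have "\<dots> = out (E \<inter> U) + out (E - U)" by simp
    finally show "out E \<le> out (E \<inter> U) + out (E - U)" .
    show "out (E \<inter> U) + out (E - U) \<le> out E"
      unfolding out_def[of E]
    proof (intro INF_greatest, safe)
      fix V assume V: "openin K V" "E \<subseteq> V"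
      \<comment> \<open>\<open>V - C\<close> is open and contains \<open>E - U\<close>, so a clopen
        \<open>C\<close> inside \<open>V \<inter> U\<close> and a clopen \<open>D\<close> inside
        \<open>V - C\<close> have total content at most \<open>inn V\<close>; then pass to suprema
        over \<open>D\<close> and over \<open>C\<close>.\<close>
      have le: "m C + out (E - U) \<le> inn V" if C: "clop C" "C \<subseteq> V \<inter> U" for C
      proof -
        have "openin K (V - C)" using V C by (auto simp: clop_def)
        then have "out (E - U) \<le> inn (V - C)" using C V by (intro out_le) auto
        then have "m C + out (E - U) \<le> m C + inn (V - C)" by (rule add_left_mono)
        also have "\<dots> = (SUP D\<in>{D. clop D \<and> D \<subseteq> V - C}. m C + m D)"
          unfolding inn_def by (intro ennreal_SUP_add_right) (auto intro: exI[of _ "{}"])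
        also have "\<dots> \<le> inn V"
        proof (intro SUP_least, safe)
          fix D assume D: "clop D" "D \<subseteq> V - C"
          have "m C + m D = m (C \<union> D)"
            using C D by (intro m_Un[symmetric]) (auto simp: clop_def)
          also have "\<dots> \<le> inn V" using C D by (intro m_le_inn clop_Un) auto
          finally show "m C + m D \<le> inn V" .
        qed
        finally show ?thesis .
      qed
      have "out (E \<inter> U) + out (E - U) \<le> inn (V \<inter> U) + out (E - U)"
        using V U by (intro add_right_mono out_le) auto
      also have "\<dots> = (SUP C\<in>{C. clop C \<and> C \<subseteq> V \<inter> U}. m C + out (E - U))"
        unfolding inn_def by (intro ennreal_SUP_add_left[symmetric]) (auto intro: exI[of _ "{}"])
      also have "\<dots> \<le> inn V" by (intro SUP_least) (use le in auto)
      finally show "out (E \<inter> U) + out (E - U) \<le> inn V" .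
    qed
  qed
  let ?B = "sigma_sets ?X {U. openin K U}"
  have ms: "measure_space ?X (lambda_system ?X (Pow ?X) out) out"
    using oms by (rule PX.caratheodory_lemma)
  interpret L: sigma_algebra ?X "lambda_system ?X (Pow ?X) out"
    using ms by (simp add: measure_space_def)
  have open_Pow: "{U. openin K U} \<subseteq> Pow ?X" by (auto dest: openin_subset)
  have "?B \<subseteq> lambda_system ?X (Pow ?X) out"
    using open_lambda by (intro L.sigma_sets_subset) auto
  then have msB: "measure_space ?X ?B out"
    using ms open_Pow by (intro measure_down[OF ms]) (auto intro: sigma_algebra_sigma_sets)
  define \<mu> where "\<mu> = measure_of ?X {U. openin K U} out"
  have space: "space \<mu> = ?X" and sets: "sets \<mu> = ?B"
    using open_Pow by (auto simp: \<mu>_def space_measure_of_conv sets_measure_of)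
  have \<mu>: "emeasure \<mu> B = out B" if "B \<in> ?B" for B
    unfolding \<mu>_def using msB open_Pow that
    by (intro emeasure_measure_of[OF refl]) (auto simp: measure_space_def sets_measure_of)
  have open_B: "U \<in> ?B" if "openin K U" for U using that by (auto intro: sigma_sets.Basic)
  have closed_B: "F \<in> ?B" if F: "closedin K F" for F
  proof -
    have "?X - (?X - F) \<in> ?B" using F by (intro sigma_sets.Compl open_B) auto
    then show ?thesis using closedin_subset[OF F] by (simp add: double_diff)
  qed
  interpret \<mu>: finite_measure \<mu>
    using out_fin[of ?X] \<mu>[of ?X] open_B[of ?X] by (intro finite_measureI) (auto simp: space)
  have "radon_measure_on K \<mu>"
    unfolding radon_measure_on_def
  proof (intro conjI ballI)
    show "finite_measure \<mu>" by unfold_locales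
    fix B assume B: "B \<in> sets \<mu>"
    show "emeasure \<mu> B = (SUP C\<in>{C. compactin K C \<and> C \<subseteq> B}. emeasure \<mu> C)"
    proof (rule antisym)
      show "(SUP C\<in>{C. compactin K C \<and> C \<subseteq> B}. emeasure \<mu> C) \<le> emeasure \<mu> B"
        using B by (intro SUP_least emeasure_mono) auto
      show "emeasure \<mu> B \<le> (SUP C\<in>{C. compactin K C \<and> C \<subseteq> B}. emeasure \<mu> C)"
      proof (rule ennreal_le_epsilon)
        fix e :: real assume "0 < e"
        have "?X - B \<in> ?B" using B sets by (metis space sets.compl_sets)
        then have eq: "out (?X - B) = emeasure \<mu> (?X - B)" by (simp add: \<mu>)
        \<comment> \<open>Inner regularity at \<open>B\<close> is outer regularity at its
          complement: the complement of a tight open \<open>U\<close> is closed, hence compact, and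
          misses less than \<open>e\<close> of \<open>B\<close>.\<close>
        have "out (?X - B) < out (?X - B) + ennreal e"
          using out_fin[of "?X - B"] \<open>0 < e\<close> by (intro lt_plus) auto
        then obtain U where U: "openin K U" "?X - B \<subseteq> U" "inn U < out (?X - B) + ennreal e"
          unfolding out_def[of "?X - B"] by (auto simp: INF_less_iff)
        have UB: "U \<in> sets \<mu>" using U open_B sets by auto
        have cl: "closedin K (?X - U)" using U by auto
        have FB: "?X - U \<subseteq> B" using U by auto
        have F: "?X - U \<in> sets \<mu>" using closed_B[OF cl] sets by simp
        have "emeasure \<mu> B = emeasure \<mu> (?X - U) + emeasure \<mu> (B \<inter> U)"
        proof -
          have "B = (?X - U) \<union> (B \<inter> U)"
            using FB sets.sets_into_space[OF B] by (auto simp: space)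
          then show ?thesis
            using F B UB by (metis Diff_disjoint Int_Diff Int_assoc Int_commute Int_empty_right plus_emeasure sets.Int)
        qed
        also have "emeasure \<mu> (B \<inter> U) \<le> ennreal e"
        proof -
          have "emeasure \<mu> (?X - B) + emeasure \<mu> (B \<inter> U) = emeasure \<mu> ((?X - B) \<union> (B \<inter> U))"
            using B UB \<open>?X - B \<in> ?B\<close> sets by (intro plus_emeasure) auto
          also have "(?X - B) \<union> (B \<inter> U) = U"
            using U openin_subset[OF U(1)] by auto
          also have "emeasure \<mu> U = inn U" using \<mu>[OF open_B[OF U(1)]] out_open[OF U(1)] by simp
          also have "\<dots> \<le> emeasure \<mu> (?X - B) + ennreal e" using U(3) eq by simp
          finally show ?thesis
            by (simp add: ennreal_add_left_cancel_le)
        qed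
        also have "emeasure \<mu> (?X - U) \<le> (SUP C\<in>{C. compactin K C \<and> C \<subseteq> B}. emeasure \<mu> C)"
          using FB closedin_compact_space[OF K cl] by (intro SUP_upper) auto
        finally show "emeasure \<mu> B \<le> (SUP C\<in>{C. compactin K C \<and> C \<subseteq> B}. emeasure \<mu> C) + ennreal e"
          by (simp add: add_mono)
      qed
    qed
  qed (use space sets in auto)
  moreover have "emeasure \<mu> C = m C" if "openin K C" "closedin K C" for C
    using that \<mu>[OF open_B[OF that(1)]] out_open[OF that(1)] inn_clop[of C] by (simp add: clop_def)
  ultimately show thesis by (rule that)
qed

lemma radon_measure_on_closed:
  assumes "radon_measure_on K \<mu>" "closedin K F"
  shows "F \<in> sets \<mu>"
proof -
  have "openin K (topspace K - F)" using assms(2) by blast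
  then have "topspace K - (topspace K - F) \<in> sigma_sets (topspace K) {U. openin K U}"
    by (intro sigma_sets.Compl sigma_sets.Basic) simp
  then show ?thesis
    using assms closedin_subset[OF assms(2)] by (simp add: double_diff radon_measure_on_def)
qed

section \<open>Order topologies and maps onto cubes\<close>

lemma topspace_order_topology_of [simp]: "topspace (order_topology_of r) = Field r"
  by (auto simp: order_topology_of_def underS_def aboveS_def Field_def)

lemma openin_order_topology_rays:
  assumes "a \<in> Field r"
  shows "openin (order_topology_of r) (underS r a)" "openin (order_topology_of r) (aboveS r a)"
  using assms unfolding order_topology_of_def by (auto intro!: topology_generated_by_Basis)

lemma Hausdorff_order_topology_of:
  assumes "Well_order r"
  shows "Hausdorff_space (order_topology_of r)"
  unfolding Hausdorff_space_def
proof (intro allI impI)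
  have lin: "trans r" "antisym r" "total_on (Field r) r"
    using assms by (auto simp: well_order_on_def linear_order_on_def partial_order_on_def preorder_on_def)
  have sep: "\<exists>U V. openin (order_topology_of r) U \<and> openin (order_topology_of r) V \<and> x \<in> U \<and> y \<in> V \<and> disjnt U V"
    if xy: "(x, y) \<in> r" "x \<noteq> y" for x y
  proof (cases "\<exists>z. z \<in> underS r y \<and> z \<in> aboveS r x")
    case True
    then obtain z where z: "z \<in> underS r y" "z \<in> aboveS r x" by blast
    then have "z \<in> Field r" by (auto simp: underS_def Field_def)
    moreover have "disjnt (underS r z) (aboveS r z)"
      using lin by (auto simp: disjnt_def underS_def aboveS_def dest: antisymD)
    moreover have "x \<in> underS r z" "y \<in> aboveS r z"
      using z by (auto simp: underS_def aboveS_def)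
    ultimately show ?thesis using openin_order_topology_rays by metis
  next
    case False
    have "x \<in> Field r" "y \<in> Field r" using xy by (auto simp: Field_def)
    moreover have "disjnt (underS r y) (aboveS r x)" using False by (auto simp: disjnt_def)
    moreover have "x \<in> underS r y" "y \<in> aboveS r x"
      using xy by (auto simp: underS_def aboveS_def)
    ultimately show ?thesis using openin_order_topology_rays by metis
  qed
  fix x y assume "x \<in> topspace (order_topology_of r) \<and> y \<in> topspace (order_topology_of r) \<and> x \<noteq> y"
  then have "x \<in> Field r" "y \<in> Field r" "x \<noteq> y" by auto
  then consider "(x, y) \<in> r" | "(y, x) \<in> r" using lin(3) by (auto simp: total_on_def)
  then show "\<exists>U V. openin (order_topology_of r) U \<and> openin (order_topology_of r) V \<and> x \<in> U \<and> y \<in> V \<and> disjnt U V"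
  proof cases
    case 1 then show ?thesis using sep \<open>x \<noteq> y\<close> by blast
  next
    case 2 then show ?thesis using sep[of y x] \<open>x \<noteq> y\<close> by (metis disjnt_sym)
  qed
qed

text \<open>Only the part of \<open>U\<close> up to \<open>b\<close> is described, which suits an
  induction over initial segments. For a least \<open>b\<close> only the first alternative can
  hold.\<close>

lemma order_topology_left_neighbourhood:
  assumes r: "Well_order r"
    and U: "openin (order_topology_of r) U" and b: "b \<in> U"
  shows "under r b \<subseteq> U \<or> (\<exists>c\<in>underS r b. under r b \<inter> aboveS r c \<subseteq> U)"
proof -
  have lin: "trans r" "antisym r"
    using r by (auto simp: well_order_on_def linear_order_on_def partial_order_on_def preorder_on_def)
  have "generate_topology_on (insert (Field r) (underS r ` Field r \<union> aboveS r ` Field r)) U"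
    using U unfolding order_topology_of_def by (rule openin_topology_generated_by)
  then show ?thesis using b
  proof (induction U)
    case (Int U V)
    have mono: "aboveS r d \<subseteq> aboveS r c" if "(c, d) \<in> r" for c d
      using that lin by (auto simp: aboveS_def dest: transD antisymD)
    have UV: "under r b \<subseteq> U \<or> (\<exists>c\<in>underS r b. under r b \<inter> aboveS r c \<subseteq> U)"
      "under r b \<subseteq> V \<or> (\<exists>c\<in>underS r b. under r b \<inter> aboveS r c \<subseteq> V)"
      using Int by auto
    \<comment> \<open>Of two cut points below \<open>b\<close>, the later one serves both
      neighbourhoods.\<close>
    have "(c, d) \<in> r \<or> (d, c) \<in> r" if "c \<in> underS r b" "d \<in> underS r b" for c d
      using that r wo_rel.TOTALS[of r] by (auto simp: wo_rel_def underS_def dest: FieldI1)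
    then show ?case using UV mono by (smt (verit) Int_iff le_inf_iff subset_iff)
  next
    case (UN \<U>)
    then obtain V where V: "V \<in> \<U>" "b \<in> V" by blast
    then have "under r b \<subseteq> V \<or> (\<exists>c\<in>underS r b. under r b \<inter> aboveS r c \<subseteq> V)"
      using UN by blast
    then show ?case using V by blast
  next
    case (Basis V)
    then consider "V = Field r" | a where "a \<in> Field r" "V = underS r a" | a where "a \<in> Field r" "V = aboveS r a"
      by blast
    then show ?case
    proof cases
      case 1 then show ?thesis by (auto simp: under_def Field_def)
    next
      case 2 then show ?thesis using lin Basis
        by (auto simp: under_def underS_def dest: transD antisymD)
    next
      case 3 then show ?thesis using Basis by (auto simp: underS_def aboveS_def)
    qed
  qed auto
qed

text \<open>Induction along the well-order on the image of \<open>under r b\<close>. By continuity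
  at \<open>b\<close>, the points up to \<open>b\<close> whose value is at least
  \<open>1 / (n + 1)\<close> away from \<open>g b\<close> all lie below some \<open>c\<close> before
  \<open>b\<close>; the union over \<open>n\<close> adds only the value \<open>g b\<close>.\<close>

lemma countable_image_compact_ordinal:
  assumes r: "Well_order r" and X: "compact_space (order_topology_of r)"
    and g: "continuous_map (order_topology_of r) euclideanreal g"
  shows "countable (g ` Field r)"
proof -
  have wf: "wf (r - Id)" using r by (simp add: well_order_on_def)
  have below: "countable (g ` under r b)" if "b \<in> Field r" for b
    using wf that
  proof (induction b rule: wf_induct_rule)
    case (less b)
    define U where "U n = {x \<in> Field r. \<bar>g x - g b\<bar> < 1 / real (Suc n)}" for n
    have "openin (order_topology_of r) {x \<in> topspace (order_topology_of r). g x \<in> ball (g b) (1 / real (Suc n))}" for n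
      using g by (rule openin_continuous_map_preimage) simp
    then have U: "openin (order_topology_of r) (U n)" for n
      by (simp add: U_def dist_real_def abs_minus_commute)
    have "countable (g ` (under r b - U n))" for n
    proof -
      have "b \<in> U n" using less.prems by (simp add: U_def)
      from order_topology_left_neighbourhood[OF r U this]
      consider "under r b \<subseteq> U n" | c where "c \<in> underS r b" "under r b \<inter> aboveS r c \<subseteq> U n" by blast
      then show ?thesis
      proof cases
        case 1 then show ?thesis by (simp add: Diff_eq_empty_iff[THEN iffD2])
      next
        case 2
        have "under r b - U n \<subseteq> under r c"
        proof
          fix x assume x: "x \<in> under r b - U n"
          then have "x \<in> Field r" "c \<in> Field r" "x \<notin> aboveS r c"
            using 2 by (auto simp: under_def underS_def Field_def)
          then show "x \<in> under r c"
            using r wo_rel.TOTALS[of r] wo_rel.REFL[of r]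
            by (auto simp: wo_rel_def under_def aboveS_def refl_on_def)
        qed
        moreover have "countable (g ` under r c)"
          using 2 by (intro less.IH) (auto simp: underS_def Field_def)
        ultimately show ?thesis by (meson countable_subset image_mono)
      qed
    qed
    then have "countable (insert (g b) (\<Union>n. g ` (under r b - U n)))" by simp
    moreover have "g ` under r b \<subseteq> insert (g b) (\<Union>n. g ` (under r b - U n))"
    proof safe
      fix x assume x: "x \<in> under r b" "g x \<notin> (\<Union>n. g ` (under r b - U n))"
      then have "\<bar>g x - g b\<bar> < 1 / real (Suc n)" for n
        by (auto simp: U_def)
      then have "\<not> 0 < \<bar>g x - g b\<bar>"
        using nat_approx_posE by (metis less_asym)
      then show "g x = g b" by simp
    qed
    ultimately show ?case by (rule countable_subset[rotated])
  qed
  show ?thesis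
  proof (cases "\<exists>b\<in>Field r. Field r \<subseteq> under r b")
    case True
    then show ?thesis using below by (meson countable_subset image_mono)
  next
    case False
    \<comment> \<open>Without a largest element every point lies strictly below another, so the open
      initial segments cover, and compactness leaves finitely many of them.\<close>
    have "Field r \<subseteq> \<Union>(underS r ` Field r)"
    proof
      fix x assume "x \<in> Field r"
      with False obtain y where "y \<in> Field r" "(y, x) \<notin> r" by (auto simp: under_def)
      then show "x \<in> \<Union>(underS r ` Field r)"
        using r wo_rel.TOTALS[of r] wo_rel.REFL[of r] \<open>x \<in> Field r\<close>
        by (auto simp: wo_rel_def refl_on_def underS_def intro!: bexI[of _ y])
    qed
    then obtain \<F> where \<F>: "finite \<F>" "\<F> \<subseteq> underS r ` Field r" "Field r \<subseteq> \<Union>\<F>"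
      using X openin_order_topology_rays(1)[of _ r]
      unfolding compact_space_alt by (metis (no_types, lifting) imageE topspace_order_topology_of)
    then obtain N where N: "finite N" "N \<subseteq> Field r" "\<F> = underS r ` N" by (meson finite_subset_image)
    have "g ` Field r \<subseteq> (\<Union>b\<in>N. g ` under r b)"
      using \<F> N by (force simp: under_def underS_def)
    moreover have "countable (\<Union>b\<in>N. g ` under r b)"
      using N below by (intro countable_UN) (auto intro: countable_finite)
    ultimately show ?thesis by (rule countable_subset)
  qed
qed

section \<open>Continuous maps onto uncountable cubes\<close>

text \<open>Countably many steps decide all digits of \<open>f\<close> but fix only countably many
  coordinates of the cube; a coordinate left over then takes all values in \<open>[0,1]\<close> on a
  single fibre.\<close>

proposition no_map_onto_uncountable_cube:
  fixes K :: "'a topology" and T :: "'i set"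
  assumes K: "compact_space K" and f: "continuous_map K cantor_space f" and T: "uncountable T"
    and fibre: "\<And>t h. continuous_map (subtopology K {x \<in> topspace K. f x = t}) euclideanreal h \<Longrightarrow>
                  countable (h ` {x \<in> topspace K. f x = t})"
    and g: "continuous_map K (product_topology (\<lambda>_. top_of_set {0..1::real}) T) g"
  shows "g ` topspace K \<noteq> topspace (product_topology (\<lambda>_. top_of_set {0..1::real}) T)"
proof
  define P where "P = product_topology (\<lambda>_::'i. top_of_set {0..1::real}) T"
  assume "g ` topspace K = topspace (product_topology (\<lambda>_. top_of_set {0..1::real}) T)"
  then have onto: "g ` topspace K = topspace P" by (simp add: P_def)
  have gP: "continuous_map K P g" using g by (simp add: P_def)
  have P_top: "topspace P = (\<Pi>\<^sub>E i\<in>T. {0..1})" by (simp add: P_def)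
  have P_Haus: "Hausdorff_space P"
    by (auto simp: P_def Hausdorff_space_product_topology intro: Hausdorff_space_subtopology)
  \<comment> \<open>The invariant of the recursion is \<open>full\<close>: the closed set
    \<open>L\<close>, cut out by the digits decided so far, still covers a subcube of finite
    codimension.\<close>
  define subcube where "subcube s J = {z \<in> topspace P. \<forall>i\<in>J. z i = s i}" for s :: "'i \<Rightarrow> real" and J
  define full where "full s J L \<longleftrightarrow> finite J \<and> s \<in> topspace P \<and> closedin K L \<and> subcube s J \<subseteq> g ` L" for s J L
  define half where "half n b = {x \<in> topspace K. f x n = b}" for n :: nat and b :: bool
  have closed_half: "closedin K (half n b)" for n b
  proof -
    have "continuous_map K (discrete_topology UNIV) (\<lambda>x. f x n)"
      using f by (simp add: cantor_space_def continuous_map_componentwise_UNIV)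
    from closedin_continuous_map_preimage[OF this, of "{b}"] show ?thesis
      by (simp add: half_def)
  qed
  have step: "\<exists>s' J' b. full s' J' (L \<inter> half n b) \<and> J \<subseteq> J' \<and> (\<forall>i\<in>J. s' i = s i)"
    if full: "full s J L" for s J L n
  proof (cases "subcube s J \<subseteq> g ` (L \<inter> half n True)")
    case True
    then have "full s J (L \<inter> half n True)"
      using full closed_half by (auto simp: full_def)
    then show ?thesis by blast
  next
    case False
    \<comment> \<open>A point \<open>z\<close> missed by the half with digit \<open>True\<close> has
      a basic neighbourhood missed by it, since the image is compact and so closed. Over that
      neighbourhood all preimages in \<open>L\<close> have digit \<open>False\<close>.\<close>
    then obtain z where z: "z \<in> subcube s J" "z \<notin> g ` (L \<inter> half n True)" by blast
    have "compactin K (L \<inter> half n True)"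
      using full closed_half by (intro closedin_compact_space[OF K]) (auto simp: full_def)
    then have "closedin P (g ` (L \<inter> half n True))"
      using image_compactin[OF _ gP] compactin_imp_closedin[OF P_Haus] by blast
    define W where "W = topspace P - g ` (L \<inter> half n True)"
    have "openin P W" using \<open>closedin P _\<close> by (simp add: closedin_def W_def)
    moreover have "z \<in> W" using z by (auto simp: subcube_def W_def)
    ultimately have "\<exists>V. finite {i \<in> T. V i \<noteq> topspace (top_of_set {0..1::real})} \<and>
        (\<forall>i\<in>T. openin (top_of_set {0..1}) (V i)) \<and> z \<in> Pi\<^sub>E T V \<and> Pi\<^sub>E T V \<subseteq> W"
      unfolding P_def openin_product_topology_alt by (rule bspec)
    then obtain V where V: "finite {i \<in> T. V i \<noteq> {0..1::real}}" "z \<in> Pi\<^sub>E T V" "Pi\<^sub>E T V \<subseteq> W"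
      by auto
    \<comment> \<open>Fixing to \<open>z\<close> also the finitely many coordinates that
      \<open>V\<close> restricts forces a point into \<open>V\<close>.\<close>
    define J' where "J' = J \<union> {i \<in> T. V i \<noteq> {0..1}}"
    have sub: "subcube z J' \<subseteq> Pi\<^sub>E T V"
    proof
      fix y assume y: "y \<in> subcube z J'"
      have "y i \<in> V i" if "i \<in> T" for i
      proof (cases "V i = {0..1}")
        case True then show ?thesis using y that by (auto simp: subcube_def P_top)
      next
        case False
        then have "y i = z i" using y that by (auto simp: subcube_def J'_def)
        then show ?thesis using V(2) that by auto
      qed
      then show "y \<in> Pi\<^sub>E T V" using y by (auto simp: subcube_def P_top PiE_def)
    qed
    have "subcube z J' \<subseteq> g ` (L \<inter> half n False)"
    proof
      fix y assume y: "y \<in> subcube z J'"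
      then have "y \<in> subcube s J" using z by (auto simp: subcube_def J'_def)
      then obtain x where x: "x \<in> L" "y = g x" using full by (auto simp: full_def)
      have "y \<notin> g ` (L \<inter> half n True)" using y sub V(3) unfolding W_def by blast
      then have "x \<notin> half n True" using x by blast
      moreover have "x \<in> topspace K" using x full closedin_subset by (auto simp: full_def)
      ultimately show "y \<in> g ` (L \<inter> half n False)" using x by (auto simp: half_def)
    qed
    then have "full z J' (L \<inter> half n False)"
      using full closed_half V z by (auto simp: full_def J'_def subcube_def)
    moreover have "J \<subseteq> J'" "\<forall>i\<in>J. z i = s i" using z by (auto simp: J'_def subcube_def)
    ultimately show ?thesis by blast
  qed
  define s0 where "s0 = restrict (\<lambda>_::'i. 0::real) T"
  have s0: "s0 \<in> topspace P" by (auto simp: s0_def P_top)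
  have full0: "full s0 {} (topspace K)"
    using s0 onto by (auto simp: full_def subcube_def)
  \<comment> \<open>The index \<open>n\<close> is a dummy argument, giving \<open>good\<close> the
    shape that \<open>dependent_nat_choice\<close> asks for.\<close>
  define good where "good n S = (case S of (s, J, L) \<Rightarrow> full s J L)" for n :: nat and S
  define next_state where "next_state n S S' = (case S of (s, J, L) \<Rightarrow> case S' of (s', J', L') \<Rightarrow>
      J \<subseteq> J' \<and> (\<forall>i\<in>J. s' i = s i) \<and> (\<exists>b. L' = L \<inter> half n b))"
    for n and S S' :: "('i \<Rightarrow> real) \<times> 'i set \<times> 'a set"
  have "\<exists>S. \<forall>n. good n (S n) \<and> next_state n (S n) (S (Suc n))"
  proof (rule dependent_nat_choice)
    show "\<exists>S. good 0 S" using full0 by (auto simp: good_def)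
    fix S n assume "good n S"
    then show "\<exists>S'. good (Suc n) S' \<and> next_state n S S'"
      using step by (cases S) (fastforce simp: good_def next_state_def)
  qed
  then obtain S where S: "\<And>n. good n (S n)" "\<And>n. next_state n (S n) (S (Suc n))" by blast
  define s J L where "s n = fst (S n)" and "J n = fst (snd (S n))" and "L n = snd (snd (S n))" for n
  have fullS: "full (s n) (J n) (L n)" for n
    using S(1)[of n] by (auto simp: good_def s_def J_def L_def split: prod.splits)
  have nxt: "J n \<subseteq> J (Suc n)" "\<And>i. i \<in> J n \<Longrightarrow> s (Suc n) i = s n i" "\<exists>b. L (Suc n) = L n \<inter> half n b" for n
    using S(2)[of n] by (auto simp: next_state_def s_def J_def L_def split: prod.splits)
  obtain t where t: "\<And>n. L (Suc n) = L n \<inter> half n (t n)" using nxt(3) by metis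
  have Jmono: "J m \<subseteq> J n" if "m \<le> n" for m n
    using nxt(1) that by (rule lift_Suc_mono_le)
  have s_stable: "s n i = s m i" if "m \<le> n" "i \<in> J m" for m n i
    using that
  proof (induction n rule: dec_induct)
    case (step n)
    then show ?case using nxt(2)[of i n] Jmono[of m n] by auto
  qed simp
  have "countable (\<Union>n. J n)" using fullS by (auto simp: full_def intro: countable_finite)
  then have "\<not> T \<subseteq> (\<Union>n. J n)" using T countable_subset by blast
  then obtain \<alpha> where \<alpha>: "\<alpha> \<in> T" "\<And>n. \<alpha> \<notin> J n" by blast
  define F where "F = {x \<in> topspace K. f x = t}"
  have "{0..1} \<subseteq> (\<lambda>x. g x \<alpha>) ` F"
  proof
    fix u :: real assume u: "u \<in> {0..1}"
    \<comment> \<open>The point of the cube with value \<open>u\<close> at \<alpha> that obeys all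
      the constraints. By \<open>s_stable\<close> any stage containing \<open>i\<close> gives the
      same value; \<open>LEAST\<close> just picks one. Outside \<open>T\<close> the value is
      \<open>undefined\<close>, as extensionality demands.\<close>
    define z where "z i = (if i \<notin> T then undefined else if i = \<alpha> then u
      else if \<exists>n. i \<in> J n then s (LEAST n. i \<in> J n) i else 0)" for i
    have sn: "s n \<in> topspace P" for n using fullS by (auto simp: full_def)
    have zP: "z \<in> topspace P"
      using sn u by (simp add: P_top z_def PiE_iff extensional_def)
    have z_eq: "z i = s n i" if "i \<in> J n" for i n
    proof (cases "i \<in> T")
      case True
      have "s n i = s (LEAST n. i \<in> J n) i"
        using that LeastI[of "\<lambda>n. i \<in> J n" n] by (intro s_stable) (auto intro: Least_le)
      then show ?thesis using True that \<alpha> by (auto simp: z_def)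
    next
      case False
      then show ?thesis using sn[of n] by (auto simp: z_def P_top PiE_iff extensional_def)
    qed
    \<comment> \<open>A point in all \<open>D n\<close> is mapped to \<open>z\<close> by
      \<open>g\<close>, and has \<open>n\<close>-th digit \<open>t n\<close> since it lies in
      \<open>L (Suc n)\<close>.\<close>
    define D where "D n = L n \<inter> {x \<in> topspace K. g x \<in> {z}}" for n
    have "(\<Inter>n. D n) \<noteq> {}"
    proof (rule compact_space_imp_nest[OF K])
      show "closedin K (D n)" for n
        unfolding D_def using fullS zP P_Haus
        by (intro closedin_Int closedin_continuous_map_preimage[OF gP])
           (auto simp: full_def closedin_Hausdorff_singleton)
      show "D n \<noteq> {}" for n
      proof -
        have "z \<in> subcube (s n) (J n)" using zP z_eq by (auto simp: subcube_def)
        then obtain x where "x \<in> L n" "g x = z" using fullS[of n] by (auto simp: full_def)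
        moreover have "L n \<subseteq> topspace K" using fullS[of n] closedin_subset by (auto simp: full_def)
        ultimately show ?thesis by (auto simp: D_def)
      qed
      show "decseq D" using t by (intro decseq_SucI) (auto simp: D_def)
    qed
    then obtain x where x: "\<And>n. x \<in> D n" by blast
    have "f x n = t n" for n using x[of "Suc n"] t[of n] by (auto simp: D_def half_def)
    then have "x \<in> F" using x[of 0] by (auto simp: F_def D_def)
    moreover have "g x \<alpha> = u" using x[of 0] \<alpha> by (auto simp: D_def z_def)
    ultimately show "u \<in> (\<lambda>x. g x \<alpha>) ` F" by blast
  qed
  moreover have "countable ((\<lambda>x. g x \<alpha>) ` F)"
    unfolding F_def
  proof (rule fibre, rule continuous_map_from_subtopology)
    have "continuous_map K (top_of_set {0..1::real}) (\<lambda>x. g x \<alpha>)"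
      using g \<alpha> by (simp add: continuous_map_componentwise)
    then show "continuous_map K euclideanreal (\<lambda>x. g x \<alpha>)"
      by (rule continuous_map_into_fulltopology)
  qed
  ultimately have "countable {0..1::real}" by (rule countable_subset)
  then show False using uncountable_closed_interval[of 0 1] by simp
qed

lemma Hausdorff_cantor_space: "Hausdorff_space cantor_space"
  by (simp add: cantor_space_def Hausdorff_space_product_topology)

lemma uncountable_Field_cardSuc_natLeq: "uncountable (Field (cardSuc natLeq))"
proof
  let ?F = "Field (cardSuc natLeq) :: nat set set"
  assume "countable ?F"
  then have "(card_of ?F, natLeq) \<in> ordLeq"
    by (simp add: countable_card_le_natLeq)
  moreover have "(card_of ?F, cardSuc natLeq) \<in> ordIso"
    using cardSuc_Card_order[OF natLeq_Card_order] by (rule card_of_Field_ordIso)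
  ultimately have "(cardSuc natLeq, natLeq) \<in> ordLeq"
    by (metis ordIso_ordLeq_trans ordIso_symmetric)
  then show False
    using cardSuc_greater[OF natLeq_Card_order] not_ordLess_ordLeq by blast
qed

section \<open>Closures of families of binary codes\<close>

text \<open>The closure of the range of \<phi> in the Cantor cube. Reading \<open>\<phi> w i\<close>
  as membership of \<open>w\<close> in the \<open>i\<close>-th set, its points are the ultrafilters
  of the algebra generated by these sets, and \<open>code_space \<phi>\<close> is the Stone
  space.\<close>

definition approximable :: "('w \<Rightarrow> 'i \<Rightarrow> bool) \<Rightarrow> ('i \<Rightarrow> bool) set" where
  "approximable \<phi> = {p. \<forall>I. finite I \<longrightarrow> (\<exists>w. \<forall>i\<in>I. p i = \<phi> w i)}"

definition code_space :: "('w \<Rightarrow> 'i \<Rightarrow> bool) \<Rightarrow> ('i \<Rightarrow> bool) topology" where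
  "code_space \<phi> = subtopology (product_topology (\<lambda>_. discrete_topology UNIV) UNIV) (approximable \<phi>)"

definition agreeing :: "('w \<Rightarrow> 'i \<Rightarrow> bool) \<Rightarrow> 'i set \<Rightarrow> ('i \<Rightarrow> bool) \<Rightarrow> ('i \<Rightarrow> bool) set" where
  "agreeing \<phi> I p = {q \<in> approximable \<phi>. \<forall>i\<in>I. q i = p i}"

lemma approximableD:
  assumes "p \<in> approximable \<phi>" "finite I"
  obtains w where "\<And>i. i \<in> I \<Longrightarrow> p i = \<phi> w i"
  using assms by (auto simp: approximable_def)

lemma code_approximable: "\<phi> w \<in> approximable \<phi>"
  by (auto simp: approximable_def)

lemma topspace_code_space [simp]: "topspace (code_space \<phi>) = approximable \<phi>"
  by (simp add: code_space_def)

lemma continuous_map_code_space_coordinate: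
  "continuous_map (code_space \<phi>) (discrete_topology UNIV) (\<lambda>p. p i)"
  unfolding code_space_def
  by (intro continuous_map_from_subtopology continuous_map_product_projection) simp

lemma clopen_coordinate:
  "openin (code_space \<phi>) {p \<in> approximable \<phi>. p i = b}"
  "closedin (code_space \<phi>) {p \<in> approximable \<phi>. p i = b}"
  using openin_continuous_map_preimage[OF continuous_map_code_space_coordinate[of \<phi> i], of "{b}"]
    closedin_continuous_map_preimage[OF continuous_map_code_space_coordinate[of \<phi> i], of "{b}"]
  by simp_all

lemma clopen_agreeing:
  assumes "finite I"
  shows "openin (code_space \<phi>) (agreeing \<phi> I p)" "closedin (code_space \<phi>) (agreeing \<phi> I p)"
proof -
  have eq: "agreeing \<phi> I p = approximable \<phi> \<inter> (\<Inter>i\<in>I. {q \<in> approximable \<phi>. q i = p i})"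
    by (auto simp: agreeing_def)
  have "openin (code_space \<phi>) (agreeing \<phi> I p) \<and> closedin (code_space \<phi>) (agreeing \<phi> I p)"
    using assms unfolding eq
  proof (induction I)
    case empty
    then show ?case
      using openin_topspace[of "code_space \<phi>"] closedin_topspace[of "code_space \<phi>"] by simp
  next
    case (insert i I)
    have eq: "approximable \<phi> \<inter> (\<Inter>j\<in>insert i I. {q \<in> approximable \<phi>. q j = p j}) =
        {q \<in> approximable \<phi>. q i = p i} \<inter> (approximable \<phi> \<inter> (\<Inter>j\<in>I. {q \<in> approximable \<phi>. q j = p j}))"
      by auto
    show ?case
      unfolding eq
      using openin_Int[OF clopen_coordinate(1)[of \<phi> i "p i"] conjunct1[OF insert.IH]]
        closedin_Int[OF clopen_coordinate(2)[of \<phi> i "p i"] conjunct2[OF insert.IH]]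
      by (rule conjI)
  qed
  then show "openin (code_space \<phi>) (agreeing \<phi> I p)" "closedin (code_space \<phi>) (agreeing \<phi> I p)"
    by auto
qed

lemma code_space_basis:
  assumes U: "openin (code_space \<phi>) U" and p: "p \<in> U"
  obtains I where "finite I" "p \<in> agreeing \<phi> I p" "agreeing \<phi> I p \<subseteq> U"
proof -
  obtain V where V: "openin (product_topology (\<lambda>_. discrete_topology UNIV) UNIV) V" "U = V \<inter> approximable \<phi>"
    using U by (auto simp: code_space_def openin_subtopology)
  have "p \<in> V" using p V by auto
  with V(1) have "\<exists>X. finite {i \<in> UNIV. X i \<noteq> topspace (discrete_topology UNIV)} \<and>
      (\<forall>i\<in>UNIV. openin (discrete_topology UNIV) (X i)) \<and> p \<in> Pi\<^sub>E UNIV X \<and> Pi\<^sub>E UNIV X \<subseteq> V"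
    unfolding openin_product_topology_alt by (rule bspec)
  then obtain X where X: "finite {i. X i \<noteq> UNIV}" "p \<in> Pi\<^sub>E UNIV X" "Pi\<^sub>E UNIV X \<subseteq> V" by auto
  show thesis
  proof
    show "finite {i. X i \<noteq> UNIV}" by fact
    show "p \<in> agreeing \<phi> {i. X i \<noteq> UNIV} p" using p V by (simp add: agreeing_def)
    show "agreeing \<phi> {i. X i \<noteq> UNIV} p \<subseteq> U"
    proof
      fix q assume q: "q \<in> agreeing \<phi> {i. X i \<noteq> UNIV} p"
      have "q i \<in> X i" for i
        using q X(2) by (cases "X i = UNIV") (auto simp: agreeing_def)
      then show "q \<in> U" using q X(3) V(2) by (auto simp: agreeing_def)
    qed
  qed
qed

lemma code_space_clopen_basis:
  assumes "openin (code_space \<phi>) U" "p \<in> U"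
  shows "\<exists>C. openin (code_space \<phi>) C \<and> closedin (code_space \<phi>) C \<and> p \<in> C \<and> C \<subseteq> U"
  using code_space_basis[OF assms] clopen_agreeing by metis

lemma Hausdorff_code_space: "Hausdorff_space (code_space \<phi>)"
  unfolding code_space_def
  by (intro Hausdorff_space_subtopology) (simp add: Hausdorff_space_product_topology)

text \<open>A finite \<open>I\<close> that witnesses failure for \<open>p\<close> does so for every
  \<open>q\<close> agreeing with \<open>p\<close> on \<open>I\<close>; hence the subspace is closed
  in a compact cube.\<close>

lemma compact_code_space: "compact_space (code_space \<phi>)"
proof -
  let ?P = "product_topology (\<lambda>_. discrete_topology UNIV) UNIV :: ('i \<Rightarrow> bool) topology"
  have P: "compact_space ?P"
    by (simp add: compact_space_product_topology compact_space_discrete_topology)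
  have "openin ?P (- approximable \<phi>)"
  proof (subst openin_subopen, safe)
    fix p assume "p \<notin> approximable \<phi>"
    then obtain I where I: "finite I" "\<And>w. \<exists>i\<in>I. p i \<noteq> \<phi> w i" by (auto simp: approximable_def)
    let ?U = "Pi\<^sub>E UNIV (\<lambda>i. if i \<in> I then {p i} else UNIV)"
    have "openin ?P ?U"
      using I by (subst openin_PiE_gen) auto
    moreover have "p \<in> ?U" by auto
    moreover have "?U \<subseteq> - approximable \<phi>"
    proof
      fix q assume "q \<in> ?U"
      then have q: "q i = p i" if "i \<in> I" for i using that by (auto simp: PiE_iff split: if_splits)
      show "q \<in> - approximable \<phi>"
      proof
        assume "q \<in> approximable \<phi>"
        then obtain w where "\<And>i. i \<in> I \<Longrightarrow> q i = \<phi> w i" using I(1) by (rule approximableD) auto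
        then show False using I(2)[of w] q by auto
      qed
    qed
    ultimately show "\<exists>T. openin ?P T \<and> p \<in> T \<and> T \<subseteq> - approximable \<phi>" by blast
  qed
  then have "closedin ?P (approximable \<phi>)" by (simp add: closedin_def Compl_eq_Diff_UNIV)
  then show ?thesis
    unfolding code_space_def using P by (intro compact_space_subtopology closedin_compact_space)
qed

lemma code_vimage_agreeing: "\<phi> -` agreeing \<phi> I p = {w. \<forall>i\<in>I. \<phi> w i = p i}"
  by (auto simp: agreeing_def code_approximable)

text \<open>A clopen set is compact, hence a finite union of sets \<open>agreeing \<phi> I p\<close>
  with \<open>I\<close> finite, whose preimages are finite intersections of sets
  \<open>{w. \<phi> w i}\<close> and their complements.\<close>

lemma sets_code_vimage_clopen:
  assumes M: "space M = UNIV" "\<And>i. {w. \<phi> w i} \<in> sets M"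
    and C: "openin (code_space \<phi>) C" "closedin (code_space \<phi>) C"
  shows "\<phi> -` C \<in> sets M"
proof -
  have half: "{w. \<phi> w i = b} \<in> sets M" for i b
    using M(2)[of i] sets.compl_sets[OF M(2)[of i]] by (cases b) (auto simp: M(1) Compl_eq_Diff_UNIV[symmetric] Collect_neg_eq)
  have agr: "\<phi> -` agreeing \<phi> I p \<in> sets M" if "finite I" for I p
  proof -
    have "{w \<in> space M. \<forall>i\<in>I. \<phi> w i = p i} \<in> sets M"
      using that half by (intro sets.sets_Collect_finite_All) (auto simp: M(1))
    then show ?thesis by (simp add: code_vimage_agreeing M(1))
  qed
  let ?\<U> = "{agreeing \<phi> I p | I p. finite I \<and> agreeing \<phi> I p \<subseteq> C}"
  have "C \<subseteq> \<Union>?\<U>"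
  proof
    fix p assume "p \<in> C"
    then obtain I where "finite I" "p \<in> agreeing \<phi> I p" "agreeing \<phi> I p \<subseteq> C"
      using code_space_basis[OF C(1)] by metis
    then show "p \<in> \<Union>?\<U>" by blast
  qed
  moreover have "compactin (code_space \<phi>) C"
    using compact_code_space C(2) by (rule closedin_compact_space)
  moreover have "\<forall>U\<in>?\<U>. openin (code_space \<phi>) U" using clopen_agreeing(1) by blast
  ultimately obtain \<F> where \<F>: "finite \<F>" "\<F> \<subseteq> ?\<U>" "C \<subseteq> \<Union>\<F>"
    unfolding compactin_def by meson
  have \<F>': "U \<subseteq> C" "\<phi> -` U \<in> sets M" if "U \<in> \<F>" for U
    using \<F>(2) that agr by auto
  then have "C = \<Union>\<F>" using \<F>(3) by (intro antisym Union_least)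
  then have "\<phi> -` C = (\<Union>U\<in>\<F>. \<phi> -` U)" by (simp add: vimage_Union)
  then show ?thesis using \<F>(1) \<F>'(2) by (simp add: sets.finite_UN)
qed

proposition radon_measure_on_code_space:
  assumes "finite_measure M" and M: "space M = UNIV" "\<And>i. {w. \<phi> w i} \<in> sets M"
  obtains \<mu> where "radon_measure_on (code_space \<phi>) \<mu>"
    and "\<And>C. openin (code_space \<phi>) C \<Longrightarrow> closedin (code_space \<phi>) C \<Longrightarrow> emeasure \<mu> C = emeasure M (\<phi> -` C)"
proof (rule radon_measure_extending_clopen_content[OF compact_code_space code_space_clopen_basis,
      where m = "\<lambda>C. emeasure M (\<phi> -` C)"])
  interpret finite_measure M by fact
  show "emeasure M (\<phi> -` (A \<union> B)) = emeasure M (\<phi> -` A) + emeasure M (\<phi> -` B)"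
    if "openin (code_space \<phi>) A" "closedin (code_space \<phi>) A"
      "openin (code_space \<phi>) B" "closedin (code_space \<phi>) B" "A \<inter> B = {}" for A B
    unfolding vimage_Un
    using that by (intro plus_emeasure[symmetric] sets_code_vimage_clopen[OF M]) auto
  show "emeasure M (\<phi> -` topspace (code_space \<phi>)) \<noteq> \<infinity>" "emeasure M (\<phi> -` {}) = 0" by simp_all
  fix \<mu> assume "radon_measure_on (code_space \<phi>) \<mu>"
    "\<And>C. openin (code_space \<phi>) C \<Longrightarrow> closedin (code_space \<phi>) C \<Longrightarrow> emeasure \<mu> C = emeasure M (\<phi> -` C)"
  then show thesis by (rule that)
qed

section \<open>Thin functions and products of geometric distributions\<close>

text \<open>\<open>(1/2) ^ h k\<close> is twice the probability that a geometric variable exceeds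
  \<open>h k\<close>.\<close>

definition thin :: "(nat \<Rightarrow> nat) set" where
  "thin = {h. summable (\<lambda>k. (1/2::real) ^ h k)}"

lemma thinI:
  assumes "\<And>N. (\<Sum>k<N. (1/2::real) ^ u k) \<le> b"
  shows "u \<in> thin"
  unfolding thin_def mem_Collect_eq by (rule summableI_nonneg_bounded[OF _ assms]) simp

text \<open>A diagonal minimum: \<open>h n\<close> enters only from position \<open>m n\<close> on,
  where its remaining sum is at most \<open>(1/2)^n\<close>.\<close>

lemma thin_lower_bound:
  fixes h :: "nat \<Rightarrow> nat \<Rightarrow> nat"
  assumes h: "\<And>n. h n \<in> thin"
  obtains u where "u \<in> thin" "\<And>n. \<forall>\<^sub>F k in sequentially. u k \<le> h n k"
proof -
  let ?f = "\<lambda>n k. (1/2::real) ^ h n k"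
  have sm: "summable (?f n)" for n using h by (simp add: thin_def)
  have "\<exists>m\<ge>n. (\<Sum>i. ?f n (i + m)) \<le> (1/2)^n" for n
  proof -
    obtain N where "\<forall>m\<ge>N. norm (\<Sum>i. ?f n (i + m)) < (1/2)^n"
      using suminf_exist_split[OF _ sm, of "(1/2)^n" n] by auto
    then have "norm (\<Sum>i. ?f n (i + max n N)) < (1/2)^n" by simp
    then show ?thesis by (intro exI[of _ "max n N"]) auto
  qed
  then obtain m where m: "\<And>n. n \<le> m n" "\<And>n. (\<Sum>i. ?f n (i + m n)) \<le> (1/2)^n" by metis
  \<comment> \<open>\<open>n \<le> m n\<close> leaves finitely many competitors at each
    \<open>k\<close>; the extra value \<open>k\<close> keeps the minimum defined and is itself
    summable.\<close>
  define S where "S k = insert k ((\<lambda>n. h n k) ` {n. m n \<le> k})" for k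
  define u where "u k = Min (S k)" for k
  have fin: "finite {n. m n \<le> k}" for k
    by (rule finite_subset[of _ "{..k}"]) (auto intro: le_trans[OF m(1)])
  have uS: "u k \<in> S k" for k unfolding u_def S_def using fin by (intro Min_in) auto
  \<comment> \<open>The extra values \<open>k\<close> contribute at most 2, and the tails of all the
    \<open>h n\<close> together at most another 2.\<close>
  have "(\<Sum>k<N. (1/2::real) ^ u k) \<le> 4" for N
  proof -
    have "(1/2::real) ^ u k \<le> (1/2)^k + (\<Sum>n<N. if m n \<le> k then ?f n k else 0)" if "k < N" for k
    proof -
      have nn: "0 \<le> (\<Sum>n<N. if m n \<le> k then ?f n k else 0)" by (intro sum_nonneg) auto
      from uS[of k] consider "u k = k" | n where "u k = h n k" "m n \<le> k" by (auto simp: S_def)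
      then show ?thesis
      proof cases
        case 2
        then have "n \<in> {..<N}" using m(1)[of n] that by simp
        then have "?f n k \<le> (\<Sum>n<N. if m n \<le> k then ?f n k else 0)"
          using 2 member_le_sum[of n "{..<N}" "\<lambda>n. if m n \<le> k then ?f n k else 0"] by auto
        then show ?thesis using 2 by (simp add: add_increasing)
      qed (use nn in simp)
    qed
    then have "(\<Sum>k<N. (1/2::real) ^ u k)
        \<le> (\<Sum>k<N. (1/2)^k + (\<Sum>n<N. if m n \<le> k then ?f n k else 0))"
      by (intro sum_mono) auto
    also have "\<dots> = (\<Sum>k<N. (1/2)^k) + (\<Sum>n<N. \<Sum>k<N. if m n \<le> k then ?f n k else 0)"
      by (simp add: sum.distrib) (rule sum.swap)
    also have "\<dots> \<le> (\<Sum>k<N. (1/2)^k) + (\<Sum>n<N. (1/2)^n)"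
    proof (intro add_left_mono sum_mono)
      fix n
      have "(\<Sum>k<N. if m n \<le> k then ?f n k else 0) = (\<Sum>k\<in>{m n..<N}. ?f n k)"
        by (subst sum.inter_filter[symmetric]) (auto intro: sum.cong)
      also have "\<dots> = (\<Sum>i<N - m n. ?f n (i + m n))"
        by (rule sum.reindex_bij_witness[of _ "\<lambda>i. i + m n" "\<lambda>k. k - m n"]) auto
      also have "\<dots> \<le> (\<Sum>i. ?f n (i + m n))"
        using summable_ignore_initial_segment[OF sm, of n "m n"] by (intro sum_le_suminf) auto
      also have "\<dots> \<le> (1/2)^n" by (rule m)
      finally show "(\<Sum>k<N. if m n \<le> k then ?f n k else 0) \<le> (1/2)^n" .
    qed
    also have "(\<Sum>k<N. (1/2::real)^k) \<le> 2"
      using sum_le_suminf[of "\<lambda>k. (1/2::real)^k" "{..<N}"] by (simp add: suminf_geometric)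
    finally show ?thesis by simp
  qed
  then have "u \<in> thin" by (rule thinI)
  moreover have "\<forall>\<^sub>F k in sequentially. u k \<le> h n k" for n
    using eventually_ge_at_top[of "m n"]
  proof eventually_elim
    case (elim k)
    then show ?case unfolding u_def S_def using fin by (intro Min_le) auto
  qed
  ultimately show thesis by (rule that)
qed

lemma id_thin: "(\<lambda>k. k) \<in> thin"
  by (simp add: thin_def summable_geometric)

text \<open>For finitely many functions the bound holds at every \<open>k\<close>, as is required
  for staying inside boxes. The value \<open>k\<close> in the minimum covers an empty
  \<open>D\<close>.\<close>

lemma thin_finite_lower_bound:
  assumes D: "finite D" "D \<subseteq> thin"
  obtains u where "u \<in> thin" "\<And>h k. h \<in> D \<Longrightarrow> u k \<le> h k"
proof
  define u where "u k = Min (insert k ((\<lambda>h. h k) ` D))" for k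
  have "(1/2::real) ^ u k \<le> (1/2) ^ k + (\<Sum>h\<in>D. (1/2) ^ h k)" for k
  proof -
    have "u k \<in> insert k ((\<lambda>h. h k) ` D)"
      unfolding u_def using D by (intro Min_in) auto
    then consider "u k = k" | h where "h \<in> D" "u k = h k" by blast
    then show ?thesis
    proof cases
      case 1
      then show ?thesis by (simp add: sum_nonneg)
    next
      case 2
      then have "(1/2::real) ^ u k \<le> (\<Sum>h\<in>D. (1/2) ^ h k)"
        using member_le_sum[of h D "\<lambda>h. (1/2::real) ^ h k"] D by simp
      then show ?thesis by (simp add: add_increasing)
    qed
  qed
  moreover have "summable (\<lambda>k. (1/2::real) ^ k + (\<Sum>h\<in>D. (1/2) ^ h k))"
    using D by (intro summable_add summable_sum) (auto simp: thin_def summable_geometric)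
  ultimately show "u \<in> thin"
    unfolding thin_def by (auto intro: summable_comparison_test'[where N=0])
  show "u k \<le> h k" if "h \<in> D" for h k
    unfolding u_def using D that by (intro Min_le) auto
qed

text \<open>\<open>u - 1\<close> shows that \<open>u\<close> is no eventual lower bound of all thin
  functions: subtraction only doubles the sum, and \<open>u k \<le> u k - 1\<close> forces
  \<open>u k = 0\<close>, while a thin function tends to infinity.\<close>

lemma thin_unbounded:
  assumes "u \<in> thin"
  shows "(\<lambda>k. u k - 1) \<in> thin" "\<not> (\<forall>\<^sub>F k in sequentially. u k \<le> u k - 1)"
proof -
  have sm: "summable (\<lambda>k. (1/2::real) ^ u k)" using assms by (simp add: thin_def)
  have "(1/2::real) ^ (j - 1) \<le> 2 * (1/2) ^ j" for j by (cases j) auto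
  then have "summable (\<lambda>k. (1/2::real) ^ (u k - 1))"
    by (intro summable_comparison_test[OF _ summable_mult[OF sm, of 2]]) auto
  then show "(\<lambda>k. u k - 1) \<in> thin" by (simp add: thin_def)
  show "\<not> (\<forall>\<^sub>F k in sequentially. u k \<le> u k - 1)"
  proof
    assume "\<forall>\<^sub>F k in sequentially. u k \<le> u k - 1"
    then have "\<forall>\<^sub>F k in sequentially. (1/2::real) ^ u k = 1"
    proof eventually_elim
      case (elim k)
      then show ?case by (cases "u k") auto
    qed
    then have "(\<lambda>k. (1/2::real) ^ u k) \<longlonglongrightarrow> 1" by (rule tendsto_eventually)
    with summable_LIMSEQ_zero[OF sm] show False using LIMSEQ_unique by fastforce
  qed
qed

section \<open>Towers of thin functions\<close>

locale thin_tower =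
  fixes W :: "(nat \<Rightarrow> nat) rel" and C :: "(nat \<Rightarrow> nat) set"
  assumes W: "Well_order W" "Field W = UNIV"
    and C_thin: "C \<subseteq> thin"
    and C_decreasing: "\<lbrakk>g \<in> C; h \<in> C; (g, h) \<in> W\<rbrakk> \<Longrightarrow> \<forall>\<^sub>F k in sequentially. h k \<le> g k"
    and C_unbounded: "u \<in> thin \<Longrightarrow> \<exists>h\<in>C. \<not> (\<forall>\<^sub>F k in sequentially. u k \<le> h k)"

lemma thin_tower_exists: "\<exists>W C. thin_tower W C"
proof -
  obtain W :: "(nat \<Rightarrow> nat) rel" where "Well_order W \<and> Field W = UNIV"
    using well_ordering ..
  then have W: "Well_order W" "Field W = UNIV" by auto
  have wf: "wf (W - Id)" using W by (simp add: well_order_on_def)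
  \<comment> \<open>\<open>wfrec\<close> passes on the predicate cut down to predecessors; the guard
    \<open>(g, h) \<in> W - Id\<close> lets the cut disappear in the equation for
    \<open>P\<close>.\<close>
  define step where "step P h \<longleftrightarrow> h \<in> thin \<and>
      (\<forall>g. (g, h) \<in> W - Id \<longrightarrow> P g \<longrightarrow> (\<forall>\<^sub>F k in sequentially. h k \<le> g k))" for P and h :: "nat \<Rightarrow> nat"
  define P where "P = wfrec (W - Id) step"
  have P: "P h \<longleftrightarrow> h \<in> thin \<and> (\<forall>g. (g, h) \<in> W - Id \<longrightarrow> P g \<longrightarrow> (\<forall>\<^sub>F k in sequentially. h k \<le> g k))" for h
    unfolding P_def by (subst wfrec[OF wf]) (simp add: step_def cut_apply)
  have "thin_tower W {h. P h}"
  proof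
    show "{h. P h} \<subseteq> thin" using P by blast
    show "\<forall>\<^sub>F k in sequentially. h k \<le> g k"
      if "g \<in> {h. P h}" "h \<in> {h. P h}" "(g, h) \<in> W" for g h
      using that P[of h] by (cases "g = h") auto
    show "\<exists>h\<in>{h. P h}. \<not> (\<forall>\<^sub>F k in sequentially. u k \<le> h k)" if u: "u \<in> thin" for u
    proof (rule ccontr)
      assume "\<not> ?thesis"
      then have below: "\<forall>\<^sub>F k in sequentially. u k \<le> g k" if "P g" for g using that by blast
      have "\<forall>\<^sub>F k in sequentially. u k - 1 \<le> g k" if "P g" for g
        by (rule eventually_mono[OF below[OF that]]) simp
      then have "P (\<lambda>k. u k - 1)" using P thin_unbounded(1)[OF u] by blast
      then show False using below thin_unbounded(2)[OF u] by blast
    qed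
  qed (use W in auto)
  then show ?thesis by blast
qed

section \<open>Products of geometric distributions\<close>

abbreviation geom :: "nat measure" where
  "geom \<equiv> measure_pmf (geometric_pmf (1/2))"

abbreviation geom_seq :: "(nat \<Rightarrow> nat) measure" where
  "geom_seq \<equiv> \<Pi>\<^sub>M i\<in>(UNIV::nat set). geom"

interpretation geom_seq: sequence_space geom
  by unfold_locales

lemma measure_geom_atMost: "measure geom {..j} = 1 - (1/2) ^ Suc j"
proof -
  have "measure geom {..j} = (\<Sum>i\<le>j. (1/2)^i * (1/2))"
    by (simp add: measure_measure_pmf_finite)
  also have "\<dots> = 1 - (1/2) ^ Suc j" by (induction j) (auto simp: field_simps)
  finally show ?thesis .
qed

text \<open>The measure is an infinite product of nonzero factors whose distances to 1 are summable,
  hence nonzero. Below \<open>m\<close> any nonempty sides are allowed, so that finitely many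
  coordinates can be pinned.\<close>

lemma measure_geom_seq_box_pos:
  assumes u: "u \<in> thin" and E: "\<And>k. m \<le> k \<Longrightarrow> {..u k} \<subseteq> E k" "\<And>k. E k \<noteq> {}"
  shows "0 < measure geom_seq (Pi UNIV E)"
proof -
  let ?p = "\<lambda>k. measure geom (E k)"
  have pos: "0 < ?p k" for k
    using E(2)[of k] by (auto simp: measure_pmf_posI set_pmf_geometric)
  have le: "norm (?p k - 1) \<le> (1/2) ^ u k" if "m \<le> k" for k
  proof -
    have "1 - (1/2) ^ Suc (u k) \<le> ?p k"
      unfolding measure_geom_atMost[symmetric]
      by (intro measure_pmf.finite_measure_mono E that) auto
    moreover have "?p k \<le> 1" by simp
    ultimately show ?thesis by (simp add: field_simps)
  qed
  have "summable (\<lambda>k. norm (?p k - 1))"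
  proof (rule summable_comparison_test')
    show "summable (\<lambda>k. (1/2::real) ^ u k)" using u by (simp add: thin_def)
    show "norm (norm (?p k - 1)) \<le> (1/2) ^ u k" if "m \<le> k" for k
      using le[OF that] by simp
  qed
  then have "convergent_prod ?p"
    by (intro abs_convergent_prod_imp_convergent_prod summable_imp_abs_convergent_prod)
  moreover have "?p k \<noteq> 0" for k using pos[of k] by linarith
  ultimately have "(\<lambda>n. \<Prod>k\<le>n. ?p k) \<longlonglongrightarrow> prodinf ?p" "prodinf ?p \<noteq> 0"
    by (auto intro: convergent_prod_LIMSEQ dest: prodinf_nonzero)
  moreover have "(\<lambda>n. \<Prod>k\<le>n. ?p k) \<longlonglongrightarrow> measure geom_seq (Pi UNIV E)"
    by (rule geom_seq.measure_PiM_countable) auto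
  ultimately have "measure geom_seq (Pi UNIV E) \<noteq> 0" using LIMSEQ_unique by metis
  then show ?thesis by (simp add: zero_less_measure_iff)
qed

text \<open>By \<open>1 - a \<le> exp (- a)\<close> the measure of the box up to \<open>N\<close> is
  at most \<open>exp\<close> of minus half the partial sum, so the partial sums stay below
  \<open>- 2 * ln c\<close>.\<close>

lemma thinI_measure_geom_seq:
  assumes c: "0 < c" "\<And>N. c \<le> measure geom_seq {x. \<forall>k\<le>N. x k \<le> u k}"
  shows "u \<in> thin"
proof -
  have "(\<Sum>k<N. (1/2::real) ^ u k) \<le> - 2 * ln c" for N
  proof -
    have "{x. \<forall>k\<le>N. x k \<le> u k} = geom_seq.emb UNIV {..N} (Pi\<^sub>E {..N} (\<lambda>k. {..u k}))"
      by (auto simp: prod_emb_def PiE_iff)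
    then have "c \<le> (\<Prod>k\<le>N. measure geom {..u k})"
      using c(2)[of N] by (simp add: geom_seq.measure_PiM_emb)
    also have "\<dots> \<le> (\<Prod>k\<le>N. exp (- ((1/2) ^ Suc (u k))))"
      unfolding measure_geom_atMost
    proof (intro prod_mono conjI)
      fix k
      show "0 \<le> 1 - (1/2::real) ^ Suc (u k)" by (simp add: power_le_one del: power_Suc)
      show "1 - (1/2::real) ^ Suc (u k) \<le> exp (- ((1/2) ^ Suc (u k)))"
        using exp_ge_add_one_self[of "- ((1/2::real) ^ Suc (u k))"] by (simp del: power_Suc)
    qed
    also have "\<dots> = exp (- (\<Sum>k\<le>N. (1/2) ^ Suc (u k)))"
      by (simp add: exp_sum sum_negf[symmetric])
    finally have "ln c \<le> - (\<Sum>k\<le>N. (1/2) ^ Suc (u k))"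
      using c(1) by (metis exp_gt_zero ln_exp ln_le_cancel_iff)
    then have "(\<Sum>k\<le>N. (1/2::real) ^ u k) \<le> - 2 * ln c"
      by (simp add: sum_divide_distrib[symmetric])
    moreover have "(\<Sum>k<N. (1/2::real) ^ u k) \<le> (\<Sum>k\<le>N. (1/2) ^ u k)"
      by (intro sum_mono2) auto
    ultimately show ?thesis by simp
  qed
  then show ?thesis by (rule thinI)
qed

section \<open>The space of a thin tower\<close>

text \<open>An index \<open>i :: nat set\<close> stands for the product set of all \<open>x\<close> whose graph, encoded by
  \<open>prod_encode\<close>, is contained in \<open>i\<close>: \<open>cyl k j\<close> for \<open>x k \<le> j\<close>, and \<open>subgraph h\<close> for \<open>x \<le> h\<close>.\<close>

definition cyl :: "nat \<Rightarrow> nat \<Rightarrow> nat set" where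
  "cyl k j = {n. fst (prod_decode n) = k \<longrightarrow> snd (prod_decode n) \<le> j}"

definition subgraph :: "(nat \<Rightarrow> nat) \<Rightarrow> nat set" where
  "subgraph h = {n. snd (prod_decode n) \<le> h (fst (prod_decode n))}"

definition cylinder_trace :: "(nat set \<Rightarrow> bool) \<Rightarrow> nat \<Rightarrow> bool" where
  "cylinder_trace p n = (case prod_decode n of (k, j) \<Rightarrow> p (cyl k j))"

lemma cylinder_trace_prod_encode [simp]: "cylinder_trace p (prod_encode (k, j)) = p (cyl k j)"
  by (simp add: cylinder_trace_def)

context thin_tower
begin

definition indices :: "nat set set" where
  "indices = range (\<lambda>(k, j). cyl k j) \<union> subgraph ` C"

text \<open>Sets outside \<open>indices\<close> get the constant value \<open>False\<close>, so the
  cube can be indexed by the whole type without adding points.\<close>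

definition code :: "(nat \<Rightarrow> nat) \<Rightarrow> nat set \<Rightarrow> bool" where
  "code x i \<longleftrightarrow> i \<in> indices \<and> (\<forall>k. prod_encode (k, x k) \<in> i)"

lemma cyl_indices: "cyl k j \<in> indices"
  by (auto simp: indices_def)

lemma indicesE:
  assumes "i \<in> indices"
  obtains k j where "i = cyl k j" | h where "h \<in> C" "i = subgraph h"
  using assms by (auto simp: indices_def)

lemma code_cyl [simp]: "code x (cyl k j) \<longleftrightarrow> x k \<le> j"
  by (auto simp: code_def cyl_indices) (auto simp: cyl_def)

lemma code_box [simp]: "h \<in> C \<Longrightarrow> code x (subgraph h) \<longleftrightarrow> (\<forall>k. x k \<le> h k)"
  by (auto simp: code_def indices_def subgraph_def)

lemma approximable_off_indices:
  assumes "p \<in> approximable code" "p i"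
  shows "i \<in> indices"
  using approximableD[OF assms(1), of "{i}"] assms(2) by (auto simp: code_def)

text \<open>A relation between finitely many indices that holds for all codes persists in their
  closure.\<close>

lemma approximable_box_cyl:
  assumes "p \<in> approximable code" "h \<in> C" "p (subgraph h)"
  shows "p (cyl k (h k))"
proof -
  obtain x where x: "\<And>i. i \<in> {subgraph h, cyl k (h k)} \<Longrightarrow> p i = code x i"
    using assms(1) by (rule approximableD[where I = "{subgraph h, cyl k (h k)}"]) auto
  then show ?thesis using x[of "subgraph h"] x[of "cyl k (h k)"] assms by simp
qed

text \<open>Eventually \<open>h \<le> g\<close>, so the subgraph of \<open>h\<close> is contained in that of \<open>g\<close> up to finitely many
  coordinates, and these are controlled by cylinders.\<close>

lemma approximable_box_earlier:
  assumes p: "p \<in> approximable code" and gh: "g \<in> C" "h \<in> C" "(g, h) \<in> W"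
    and subgraph: "p (subgraph h)" and cyl: "\<And>k. p (cyl k (g k))"
  shows "p (subgraph g)"
proof -
  obtain m where m: "\<And>k. m \<le> k \<Longrightarrow> h k \<le> g k"
    using C_decreasing[OF gh] by (auto simp: eventually_sequentially)
  let ?I = "{subgraph g, subgraph h} \<union> (\<lambda>k. cyl k (g k)) ` {..<m}"
  obtain x where x: "\<And>i. i \<in> ?I \<Longrightarrow> p i = code x i"
    using p by (rule approximableD[where I = ?I]) auto
  have h: "x k \<le> h k" for k using x[of "subgraph h"] subgraph gh by simp
  have "x k \<le> g k" for k
  proof (cases "k < m")
    case True
    then show ?thesis using x[of "cyl k (g k)"] cyl by simp
  next
    case False
    then show ?thesis using h[of k] m[of k] by simp
  qed
  then show ?thesis using x[of "subgraph g"] gh by simp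
qed

lemma sets_geom_seq_code: "{x. code x i} \<in> sets geom_seq"
proof (cases "i \<in> indices")
  case True
  then have "{x. code x i} = Pi UNIV (\<lambda>k. {j. prod_encode (k, j) \<in> i})"
    by (auto simp: code_def)
  then show ?thesis by (simp add: geom_seq.infprod_in_sets)
qed (simp add: code_def)

text \<open>Only finitely many boxes and cylinders are involved. Equality with \<open>w\<close> on
  an initial piece decides the cylinders and the boxes missing \<open>w\<close>; a thin bound on the
  rest keeps \<open>x\<close> inside the boxes containing \<open>w\<close>.\<close>

lemma code_neighbourhood_pos:
  assumes I: "finite I"
  shows "0 < measure geom_seq {x. \<forall>i\<in>I. code x i = code w i}"
proof -
  have "\<exists>D. D \<subseteq> C \<and> finite D \<and> I \<inter> subgraph ` C = subgraph ` D"
    using finite_subset_image[of "I \<inter> subgraph ` C" subgraph C] I by auto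
  then obtain D where D: "D \<subseteq> C" "finite D" "I \<inter> subgraph ` C = subgraph ` D" by blast
  have "\<exists>N. finite N \<and> I \<inter> range (\<lambda>(k, j). cyl k j) = (\<lambda>(k, j). cyl k j) ` N"
    using finite_subset_image[of "I \<inter> range (\<lambda>(k, j). cyl k j)" "\<lambda>(k, j). cyl k j" UNIV] I by auto
  then obtain N where N: "finite N" "I \<inter> range (\<lambda>(k, j). cyl k j) = (\<lambda>(k, j). cyl k j) ` N" by blast
  define D1 where "D1 = {h \<in> D. \<forall>k. w k \<le> h k}"
  \<comment> \<open>A box missing \<open>w\<close> is already missed because of the single
    coordinate \<open>\<kappa> h\<close>.\<close>
  have "\<forall>h\<in>D - D1. \<exists>k. h k < w k" by (auto simp: D1_def not_le)
  then obtain \<kappa> where \<kappa>: "\<And>h. h \<in> D - D1 \<Longrightarrow> h (\<kappa> h) < w (\<kappa> h)" by metis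
  have "finite (fst ` N \<union> \<kappa> ` (D - D1))" using N D by simp
  then obtain m where m: "fst ` N \<union> \<kappa> ` (D - D1) \<subseteq> {..<m}"
    by (meson finite_nat_iff_bounded)
  have "finite D1" "D1 \<subseteq> thin" using D C_thin by (auto simp: D1_def)
  then obtain u where u: "u \<in> thin" "\<And>h k. h \<in> D1 \<Longrightarrow> u k \<le> h k"
    by (rule thin_finite_lower_bound) blast
  define E where "E k = (if k < m then {w k} else {..u k})" for k
  have "0 < measure geom_seq (Pi UNIV E)"
    using u(1) by (rule measure_geom_seq_box_pos[where m = m]) (auto simp: E_def)
  also have "\<dots> \<le> measure geom_seq {x. \<forall>i\<in>I. code x i = code w i}"
  proof (rule geom_seq.finite_measure_mono)
    show "Pi UNIV E \<subseteq> {x. \<forall>i\<in>I. code x i = code w i}"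
    proof (intro subsetI CollectI ballI)
      fix x i assume x: "x \<in> Pi UNIV E" and i: "i \<in> I"
      have x1: "x k = w k" if "k < m" for k using x that by (auto simp: E_def Pi_iff split: if_splits)
      have x2: "x k \<le> u k" if "\<not> k < m" for k using x that by (auto simp: E_def Pi_iff split: if_splits)
      show "code x i = code w i"
      proof (cases "i \<in> indices")
        case True
        then show ?thesis
        proof (cases rule: indicesE)
          case (1 k j)
          then have "i \<in> (\<lambda>(k, j). cyl k j) ` N" using N(2) i by blast
          then obtain k' j' where kj: "(k', j') \<in> N" "i = cyl k' j'" by auto
          then have "k' < m" using m by force
          then show ?thesis using x1 kj by simp
        next
          case (2 h')
          then obtain h where h: "h \<in> D" "i = subgraph h" using D(3) i by blast
          show ?thesis
          proof (cases "h \<in> D1")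
            case True
            have "x k \<le> h k" for k
              using x1[of k] x2[of k] u(2)[OF True, of k] True by (cases "k < m") (auto simp: D1_def)
            then show ?thesis using True h D(1) by (auto simp: D1_def)
          next
            case False
            then have "\<kappa> h < m" using m h by blast
            then have "\<not> x (\<kappa> h) \<le> h (\<kappa> h)" "\<not> w (\<kappa> h) \<le> h (\<kappa> h)"
              using \<kappa>[of h] False h x1 by auto
            then show ?thesis using h D(1) by auto
          qed
        qed
      qed (simp add: code_def)
    qed
    have "{x \<in> space geom_seq. \<forall>i\<in>I. code x i = code w i} \<in> sets geom_seq"
    proof (intro sets.sets_Collect_finite_All I)
      fix i
      have "{x. \<not> code x i} = space geom_seq - {x. code x i}" by (auto simp: space_PiM)
      then have "{x. \<not> code x i} \<in> sets geom_seq" using sets_geom_seq_code[of i] by (metis sets.compl_sets)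
      then show "{x \<in> space geom_seq. code x i = code w i} \<in> sets geom_seq"
        using sets_geom_seq_code[of i] by (cases "code w i") (simp_all add: space_PiM)
    qed
    then show "{x. \<forall>i\<in>I. code x i = code w i} \<in> sets geom_seq" by (simp add: space_PiM)
  qed
  finally show ?thesis .
qed

section \<open>The measure on the tower space\<close>

abbreviation tower_space :: "(nat set \<Rightarrow> bool) topology" where
  "tower_space \<equiv> code_space code"

lemma continuous_map_cylinder_trace: "continuous_map tower_space cantor_space cylinder_trace"
  unfolding cantor_space_def continuous_map_componentwise_UNIV
  by (auto simp: cylinder_trace_def split_beta intro: continuous_map_code_space_coordinate)

lemma tower_measure:
  obtains \<mu> where "radon_measure_on tower_space \<mu>"
    and "\<And>I p. finite I \<Longrightarrow> emeasure \<mu> (agreeing code I p) = emeasure geom_seq {x. \<forall>i\<in>I. code x i = p i}"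
proof (rule radon_measure_on_code_space[of geom_seq code])
  show "finite_measure geom_seq" by unfold_locales
  show "space geom_seq = UNIV" by (simp add: space_PiM)
  show "{x. code x i} \<in> sets geom_seq" for i by (rule sets_geom_seq_code)
  fix \<mu> assume \<mu>: "radon_measure_on tower_space \<mu>"
    "\<And>C. openin tower_space C \<Longrightarrow> closedin tower_space C \<Longrightarrow> emeasure \<mu> C = emeasure geom_seq (code -` C)"
  show thesis
  proof (rule that[OF \<mu>(1)])
    show "emeasure \<mu> (agreeing code I p) = emeasure geom_seq {x. \<forall>i\<in>I. code x i = p i}" if "finite I" for I p
      using \<mu>(2)[OF clopen_agreeing[OF that]] by (simp add: code_vimage_agreeing)
  qed
qed

context
  fixes \<mu>
  assumes radon: "radon_measure_on tower_space \<mu>"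
    and \<mu>: "\<And>I p. finite I \<Longrightarrow> emeasure \<mu> (agreeing code I p) = emeasure geom_seq {x. \<forall>i\<in>I. code x i = p i}"
begin

lemma strictly_positive_tower_measure: "strictly_positive_on tower_space \<mu>"
  unfolding strictly_positive_on_def
proof (intro allI impI)
  fix U assume "openin tower_space U \<and> U \<noteq> {}"
  then have U: "openin tower_space U" "U \<noteq> {}" by auto
  then obtain p where p: "p \<in> U" by blast
  obtain I where I: "finite I" "agreeing code I p \<subseteq> U"
    using code_space_basis[OF U(1) p] by metis
  have "p \<in> approximable code" using p openin_subset[OF U(1)] by auto
  then obtain w where w: "\<And>i. i \<in> I \<Longrightarrow> p i = code w i" using I(1) by (rule approximableD) auto
  have "0 < emeasure geom_seq {x. \<forall>i\<in>I. code x i = code w i}"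
    using code_neighbourhood_pos[OF I(1), of w] by (simp add: geom_seq.emeasure_eq_measure)
  also have "\<dots> = emeasure \<mu> (agreeing code I p)"
    unfolding \<mu>[OF I(1)] using w by (intro arg_cong[where f = "emeasure geom_seq"]) auto
  also have "\<dots> \<le> emeasure \<mu> U"
    using U radon by (intro emeasure_mono I) (auto simp: radon_measure_on_def intro: sigma_sets.Basic)
  finally show "0 < emeasure \<mu> U" .
qed

lemma not_countably_determined_tower_measure: "\<not> countably_determined tower_space \<mu>"
proof
  assume "countably_determined tower_space \<mu>"
  then obtain \<F> where \<F>: "countable \<F>" "\<And>F. F \<in> \<F> \<Longrightarrow> closedin tower_space F"
    "\<And>U. openin tower_space U \<Longrightarrow> emeasure \<mu> U = (SUP F\<in>{F \<in> \<F>. F \<subseteq> U}. emeasure \<mu> F)"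
    by (auto simp: countably_determined_def)
  define U where "U h = {p \<in> approximable code. p (subgraph h) = True}" for h
  \<comment> \<open>The members of the family that can witness positive measure of a box.\<close>
  define \<G> where "\<G> = {F \<in> \<F>. 0 < emeasure \<mu> F \<and> (\<exists>h\<in>C. F \<subseteq> U h)}"
  have captured: "\<exists>F\<in>\<G>. F \<subseteq> U h" if "h \<in> C" for h
  proof -
    have "openin tower_space (U h)" unfolding U_def by (rule clopen_coordinate)
    moreover have "code h \<in> U h" using that by (simp add: U_def code_approximable)
    ultimately have "0 < emeasure \<mu> (U h)"
      using strictly_positive_tower_measure by (auto simp: strictly_positive_on_def)
    then obtain F where "F \<in> \<F>" "F \<subseteq> U h" "0 < emeasure \<mu> F"
      using \<F>(3)[OF \<open>openin tower_space (U h)\<close>] by (auto simp: less_SUP_iff)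
    then show ?thesis using that by (auto simp: \<G>_def)
  qed
  \<comment> \<open>The smallest box around \<open>F\<close>. For \<open>F\<close> in \<G> the
    \<open>LEAST\<close> is attained, since \<open>F\<close> lies in \<open>U h\<close> for some
    \<open>h\<close> in \<open>C\<close> and then \<open>h k\<close> is a candidate.\<close>
  define u where "u F k = (LEAST j. \<forall>p\<in>F. p (cyl k j))" for F :: "(nat set \<Rightarrow> bool) set" and k
  have U_cyl: "\<forall>p\<in>F. p (cyl k (h k))" if "F \<subseteq> U h" "h \<in> C" for F h k
    using that by (auto simp: U_def intro: approximable_box_cyl)
  have u_le: "u F k \<le> h k" if "F \<subseteq> U h" "h \<in> C" for F h k
    unfolding u_def using U_cyl[OF that] by (rule Least_le)
  have u_cyl: "p (cyl k (u F k))" if "F \<in> \<G>" "p \<in> F" for F p k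
  proof -
    obtain h where "h \<in> C" "F \<subseteq> U h" using \<open>F \<in> \<G>\<close> by (auto simp: \<G>_def)
    then have "\<forall>p\<in>F. p (cyl k (u F k))"
      unfolding u_def using U_cyl by (intro LeastI[of "\<lambda>j. \<forall>p\<in>F. p (cyl k j)"]) blast
    then show ?thesis using that by blast
  qed
  have u_thin: "u F \<in> thin" if F: "F \<in> \<G>" for F
  proof (rule thinI_measure_geom_seq)
    have "finite_measure \<mu>" using radon by (simp add: radon_measure_on_def)
    then have fin: "emeasure \<mu> F = ennreal (measure \<mu> F)" by (rule finite_measure.emeasure_eq_measure)
    then show "0 < measure \<mu> F" using F by (simp add: \<G>_def)
    fix N
    \<comment> \<open>\<open>F\<close> lies in every finite-dimensional box of \<open>u F\<close>,
      so \<open>measure \<mu> F\<close> is a lower bound for their measures that is uniform in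
      \<open>N\<close>.\<close>
    define I where "I = (\<lambda>k. cyl k (u F k)) ` {..N}"
    have "finite I" by (simp add: I_def)
    have "F \<subseteq> agreeing code I (\<lambda>_. True)"
      using F u_cyl closedin_subset[OF \<F>(2)] by (fastforce simp: agreeing_def I_def \<G>_def)
    then have "emeasure \<mu> F \<le> emeasure \<mu> (agreeing code I (\<lambda>_. True))"
      using radon_measure_on_closed[OF radon clopen_agreeing(2)[OF \<open>finite I\<close>]] by (rule emeasure_mono)
    also have "\<dots> = emeasure geom_seq {x. \<forall>i\<in>I. code x i = True}"
      by (rule \<mu>[OF \<open>finite I\<close>])
    also have "{x. \<forall>i\<in>I. code x i = True} = {x. \<forall>k\<le>N. x k \<le> u F k}" by (auto simp: I_def)
    finally show "measure \<mu> F \<le> measure geom_seq {x. \<forall>k\<le>N. x k \<le> u F k}"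
      by (simp add: fin geom_seq.emeasure_eq_measure)
  qed
  have "countable \<G>" using \<F>(1) by (auto simp: \<G>_def intro: countable_subset[rotated])
  \<comment> \<open>Applying \<open>C_unbounded\<close> to any thin function, here the identity,
    shows that \<open>C\<close> is nonempty.\<close>
  moreover have "\<G> \<noteq> {}" using captured C_unbounded[OF id_thin] by blast
  ultimately have G: "range (from_nat_into \<G>) = \<G>" by (rule range_from_nat_into[rotated])
  then have "u (from_nat_into \<G> n) \<in> thin" for n using u_thin by blast
  then obtain v where v: "v \<in> thin" "\<And>n. \<forall>\<^sub>F k in sequentially. v k \<le> u (from_nat_into \<G> n) k"
    by (rule thin_lower_bound[of "\<lambda>n. u (from_nat_into \<G> n)"]) blast
  obtain h where h: "h \<in> C" "\<not> (\<forall>\<^sub>F k in sequentially. v k \<le> h k)" using C_unbounded[OF v(1)] by blast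
  obtain F where F: "F \<in> \<G>" "F \<subseteq> U h" using captured[OF h(1)] by blast
  then obtain n where n: "F = from_nat_into \<G> n" using G by blast
  have "\<forall>\<^sub>F k in sequentially. v k \<le> h k"
    using v(2)[of n] by (rule eventually_mono) (use u_le[OF F(2) h(1)] n le_trans in blast)
  with h(2) show False by blast
qed

end

section \<open>The fibres as compact ordinals\<close>

definition fibre :: "(nat \<Rightarrow> bool) \<Rightarrow> (nat set \<Rightarrow> bool) set" where
  "fibre t = {p \<in> approximable code. cylinder_trace p = t}"

definition fibre_order :: "(nat \<Rightarrow> bool) \<Rightarrow> (nat set \<Rightarrow> bool) rel" where
  "fibre_order t = {(p, q). p \<in> fibre t \<and> q \<in> fibre t \<and> (\<forall>i. p i \<longrightarrow> q i)}"

lemma approximable_Int_fibre [simp]: "approximable code \<inter> fibre t = fibre t"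
  by (auto simp: fibre_def)

lemma fibre_cyl_eq:
  assumes "p \<in> fibre t" "q \<in> fibre t"
  shows "p (cyl k j) = q (cyl k j)"
  using assms by (simp add: fibre_def flip: cylinder_trace_prod_encode)

text \<open>The trace fixes all values on cylinders, so points of one fibre can differ only at
  boxes.\<close>

lemma fibre_differE:
  assumes "p \<in> fibre t" "q \<in> fibre t" "p i" "\<not> q i"
  obtains h where "h \<in> C" "p (subgraph h)" "\<not> q (subgraph h)"
proof -
  have "i \<in> indices" using assms approximable_off_indices by (auto simp: fibre_def)
  then show thesis
  proof (cases rule: indicesE)
    case (1 k j)
    then show ?thesis using assms fibre_cyl_eq by metis
  next
    case (2 h)
    then show ?thesis using assms that by blast
  qed
qed

text \<open>\<open>p (subgraph g)\<close> supplies the cylinder conditions for \<open>g\<close>,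
  which \<open>q\<close> shares with \<open>p\<close>. Thus, among the boxes that hold at some point
  of the fibre, those holding at \<open>q\<close> form an initial segment along
  \<open>W\<close>.\<close>

lemma fibre_box_earlier:
  assumes pq: "p \<in> fibre t" "q \<in> fibre t" and gh: "g \<in> C" "h \<in> C" "(g, h) \<in> W"
    and "p (subgraph g)" "q (subgraph h)"
  shows "q (subgraph g)"
proof (rule approximable_box_earlier[of q g h])
  show "q \<in> approximable code" using pq by (simp add: fibre_def)
  show "q (cyl k (g k))" for k
    using approximable_box_cyl[of p g k] pq gh \<open>p (subgraph g)\<close> fibre_cyl_eq[OF pq] by (simp add: fibre_def)
qed (use gh \<open>q (subgraph h)\<close> in auto)

lemma W_total: "(g, h) \<in> W \<or> (h, g) \<in> W"
  using W wo_rel.TOTALS[of W] by (simp add: wo_rel_def)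

text \<open>Two initial segments of a well-order are comparable.\<close>

lemma fibre_comparable:
  assumes pq: "p \<in> fibre t" "q \<in> fibre t"
  shows "(\<forall>i. p i \<longrightarrow> q i) \<or> (\<forall>i. q i \<longrightarrow> p i)"
proof (rule ccontr)
  assume "\<not> ?thesis"
  then obtain i j where "p i" "\<not> q i" "q j" "\<not> p j" by blast
  obtain g where g: "g \<in> C" "p (subgraph g)" "\<not> q (subgraph g)"
    using pq \<open>p i\<close> \<open>\<not> q i\<close> by (rule fibre_differE)
  obtain h where h: "h \<in> C" "q (subgraph h)" "\<not> p (subgraph h)"
    using pq(2,1) \<open>q j\<close> \<open>\<not> p j\<close> by (rule fibre_differE)
  show False
    using W_total[of g h] fibre_box_earlier[OF pq g(1) h(1)] fibre_box_earlier[OF pq(2,1) h(1) g(1)] g h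
    by blast
qed

lemma Field_fibre_order: "Field (fibre_order t) = fibre t"
  by (auto simp: Field_def fibre_order_def)

lemma Well_order_fibre_order: "Well_order (fibre_order t)"
proof -
  let ?r = "fibre_order t"
  have "wf (?r - Id)"
  proof (rule wfI_min)
    fix x and Q :: "(nat set \<Rightarrow> bool) set" assume x: "x \<in> Q"
    show "\<exists>z\<in>Q. \<forall>y. (y, z) \<in> ?r - Id \<longrightarrow> y \<notin> Q"
    proof (rule ccontr)
      assume "\<not> ?thesis"
      then have no_min: "\<exists>y\<in>Q. (y, z) \<in> ?r - Id" if "z \<in> Q" for z using that by blast
      have Q: "z \<in> fibre t" if "z \<in> Q" for z using no_min[OF that] by (auto simp: fibre_order_def)
      have drop: "\<exists>y\<in>Q. \<exists>h\<in>C. z (subgraph h) \<and> \<not> y (subgraph h)" if z: "z \<in> Q" for z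
      proof -
        obtain y where y: "y \<in> Q" "(y, z) \<in> ?r" "y \<noteq> z" using no_min[OF z] by blast
        then have "\<forall>i. y i \<longrightarrow> z i" by (auto simp: fibre_order_def)
        with y(3) obtain i where "z i" "\<not> y i" by blast
        then show ?thesis using fibre_differE[OF Q[OF z] Q[OF y(1)]] y(1) by metis
      qed
      \<comment> \<open>Take the first box \<open>h\<close> that holds at \<open>x\<close> and fails
        at some \<open>p\<close> in \<open>Q\<close>. A point of \<open>Q\<close> strictly below
        \<open>p\<close> loses a box \<open>g\<close> holding at \<open>p\<close>; as
        \<open>p\<close> is below \<open>x\<close>, also \<open>g\<close> is in \<open>S\<close> and
        so not before \<open>h\<close>. Then \<open>h\<close> must hold at \<open>p\<close> after
        all.\<close>
      define S where "S = {h \<in> C. x (subgraph h) \<and> (\<exists>p\<in>Q. \<not> p (subgraph h))}"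
      have "S \<noteq> {}" using drop[OF x] by (auto simp: S_def)
      moreover have "wf (W - Id)" using W by (simp add: well_order_on_def)
      ultimately obtain h where h: "h \<in> S" "\<And>g. (g, h) \<in> W - Id \<Longrightarrow> g \<notin> S"
        by (metis wfE_min ex_in_conv)
      then obtain p where p: "p \<in> Q" "\<not> p (subgraph h)" "h \<in> C" "x (subgraph h)" by (auto simp: S_def)
      obtain y g where g: "y \<in> Q" "g \<in> C" "p (subgraph g)" "\<not> y (subgraph g)" using drop[OF p(1)] by blast
      have "x (subgraph g)" using fibre_comparable[OF Q[OF x] Q[OF p(1)]] p g by blast
      then have "g \<in> S" using g by (auto simp: S_def)
      then have "(h, g) \<in> W" using h W_total[of g h] by (cases "g = h") auto
      then have "p (subgraph h)" using fibre_box_earlier[OF Q[OF x] Q[OF p(1)] p(3) g(2)] p g by blast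
      then show False using p by blast
    qed
  qed
  moreover have "total_on (fibre t) ?r"
    using fibre_comparable by (auto simp: total_on_def fibre_order_def)
  moreover have "refl_on (fibre t) ?r" "trans ?r" "antisym ?r" "?r \<subseteq> fibre t \<times> fibre t"
    by (auto simp: refl_on_def trans_def antisym_def fibre_order_def)
  ultimately show ?thesis
    unfolding Field_fibre_order
    by (auto simp: well_order_on_def linear_order_on_def partial_order_on_def preorder_on_def)
qed

text \<open>By comparability, \<open>q\<close> is strictly below \<open>p\<close> iff some index
  true at \<open>p\<close> is false at \<open>q\<close>, an open condition; dually above.\<close>

lemma openin_fibre_rays:
  assumes p: "p \<in> fibre t"
  shows "openin (subtopology tower_space (fibre t)) (underS (fibre_order t) p)"
    and "openin (subtopology tower_space (fibre t)) (aboveS (fibre_order t) p)"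
proof -
  have "underS (fibre_order t) p = (\<Union>i\<in>{i. p i}. {q \<in> approximable code. q i = False}) \<inter> fibre t"
    using p fibre_comparable[OF _ p] by (auto simp: underS_def fibre_order_def fibre_def)
  moreover have "openin tower_space (\<Union>i\<in>{i. p i}. {q \<in> approximable code. q i = False})"
    using clopen_coordinate(1)[of code _ False] by (intro openin_Union) auto
  ultimately show "openin (subtopology tower_space (fibre t)) (underS (fibre_order t) p)"
    unfolding openin_subtopology by blast
  have "aboveS (fibre_order t) p = (\<Union>i\<in>{i. \<not> p i}. {q \<in> approximable code. q i = True}) \<inter> fibre t"
    using p fibre_comparable[OF _ p] by (auto simp: aboveS_def fibre_order_def fibre_def)
  moreover have "openin tower_space (\<Union>i\<in>{i. \<not> p i}. {q \<in> approximable code. q i = True})"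
    using clopen_coordinate(1)[of code _ True] by (intro openin_Union) auto
  ultimately show "openin (subtopology tower_space (fibre t)) (aboveS (fibre_order t) p)"
    unfolding openin_subtopology by blast
qed

lemma compact_fibre: "compact_space (subtopology tower_space (fibre t))"
proof -
  have "closedin cantor_space {t}"
    using closedin_Hausdorff_singleton[OF Hausdorff_cantor_space, of t] by (simp add: cantor_space_def)
  then have "closedin tower_space {p \<in> topspace tower_space. cylinder_trace p \<in> {t}}"
    by (rule closedin_continuous_map_preimage[OF continuous_map_cylinder_trace])
  then have "closedin tower_space (fibre t)" by (simp add: fibre_def)
  then show ?thesis
    using compact_code_space by (intro compact_space_subtopology closedin_compact_space)
qed

text \<open>Open rays make the identity continuous, and a continuous bijection from a compact space
  onto a Hausdorff one is a homeomorphism.\<close>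

lemma homeomorphic_map_fibre:
  "homeomorphic_map (subtopology tower_space (fibre t)) (order_topology_of (fibre_order t)) id"
proof (rule continuous_imp_homeomorphic_map)
  have top: "topspace (subtopology tower_space (fibre t)) = fibre t"
    by simp
  show "continuous_map (subtopology tower_space (fibre t)) (order_topology_of (fibre_order t)) id"
    unfolding order_topology_of_def
  proof (rule continuous_on_generated_topo)
    fix U assume "U \<in> insert (Field (fibre_order t))
        (underS (fibre_order t) ` Field (fibre_order t) \<union> aboveS (fibre_order t) ` Field (fibre_order t))"
    then have U: "openin (subtopology tower_space (fibre t)) U"
      using openin_fibre_rays openin_topspace[of "subtopology tower_space (fibre t)"]
      unfolding top Field_fibre_order by blast
    then show "openin (subtopology tower_space (fibre t)) (id -` U \<inter> topspace (subtopology tower_space (fibre t)))"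
      unfolding vimage_id id_apply Int_absorb2[OF openin_subset[OF U]] .
  qed (auto simp: fibre_def Field_fibre_order)
  show "id ` topspace (subtopology tower_space (fibre t)) = topspace (order_topology_of (fibre_order t))"
    by (simp add: Field_fibre_order)
qed (auto intro: compact_fibre Hausdorff_order_topology_of Well_order_fibre_order)

lemma countable_image_fibre:
  assumes h: "continuous_map (subtopology tower_space (fibre t)) euclideanreal h"
  shows "countable (h ` fibre t)"
proof -
  obtain h' where h': "homeomorphic_maps (subtopology tower_space (fibre t)) (order_topology_of (fibre_order t)) id h'"
    using homeomorphic_map_fibre homeomorphic_map_maps by blast
  \<comment> \<open>The inverse of the identity is the identity on the fibre, so \<open>h\<close>
    itself is continuous for the order topology.\<close>
  have "h' p = p" if "p \<in> fibre t" for p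
    using h' that by (auto simp: homeomorphic_maps_def Field_fibre_order)
  moreover have "continuous_map (order_topology_of (fibre_order t)) euclideanreal (h \<circ> h')"
    using h' h by (intro continuous_map_compose[of _ "subtopology tower_space (fibre t)"]) (auto simp: homeomorphic_maps_def)
  ultimately have "continuous_map (order_topology_of (fibre_order t)) euclideanreal h"
    using continuous_map_eq[of "order_topology_of (fibre_order t)" euclideanreal "h \<circ> h'" h]
    by (simp add: Field_fibre_order)
  moreover have "compact_space (order_topology_of (fibre_order t))"
    using compact_fibre homeomorphic_map_fibre homeomorphic_compact_space homeomorphic_map_imp_homeomorphic_space by blast
  ultimately show ?thesis
    using countable_image_compact_ordinal[OF Well_order_fibre_order] by (simp add: Field_fibre_order)
qed

end

theorem theorem3p4:
  assumes "p_eq_c"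
  shows "\<exists>(K :: (nat set \<Rightarrow> bool) topology) (\<mu> :: (nat set \<Rightarrow> bool) measure)
            (f :: (nat set \<Rightarrow> bool) \<Rightarrow> (nat \<Rightarrow> bool)).
           compact_space K \<and> Hausdorff_space K \<and>
           radon_measure_on K \<mu> \<and> strictly_positive_on K \<mu> \<and> \<not> countably_determined K \<mu> \<and>
           continuous_map K cantor_space f \<and>
           (\<forall>t \<in> topspace cantor_space.
              homeomorphic_to_ordinal (subtopology K {x \<in> topspace K. f x = t})) \<and>
           \<not> (\<exists>g. continuous_map K tychonoff_cube_omega1 g \<and>
                  g ` topspace K = topspace tychonoff_cube_omega1)"
proof -
  obtain W C where "thin_tower W C" using thin_tower_exists by blast
  then interpret thin_tower W C .
  obtain \<mu> where \<mu>: "radon_measure_on tower_space \<mu>"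
    "\<And>I p. finite I \<Longrightarrow> emeasure \<mu> (agreeing code I p) = emeasure geom_seq {x. \<forall>i\<in>I. code x i = p i}"
    by (rule tower_measure) blast
  have fibre: "{x \<in> topspace tower_space. cylinder_trace x = t} = fibre t" for t
    by (simp add: fibre_def)
  \<comment> \<open>Over a \<open>t\<close> with empty fibre, \<open>fibre_order t\<close> is the
    empty relation, that is, the ordinal 0.\<close>
  have "homeomorphic_to_ordinal (subtopology tower_space (fibre t))" for t
    unfolding homeomorphic_to_ordinal_def
    using Well_order_fibre_order homeomorphic_map_fibre homeomorphic_map_imp_homeomorphic_space by blast
  moreover have "g ` topspace tower_space \<noteq> topspace tychonoff_cube_omega1"
    if "continuous_map tower_space tychonoff_cube_omega1 g" for g
    unfolding tychonoff_cube_omega1_def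
    using compact_code_space continuous_map_cylinder_trace uncountable_Field_cardSuc_natLeq
  proof (rule no_map_onto_uncountable_cube)
    show "countable (h ` {x \<in> topspace tower_space. cylinder_trace x = t})"
      if "continuous_map (subtopology tower_space {x \<in> topspace tower_space. cylinder_trace x = t}) euclideanreal h" for t h
      using that unfolding fibre by (rule countable_image_fibre)
    show "continuous_map tower_space (product_topology (\<lambda>_. top_of_set {0..1}) (Field (cardSuc natLeq))) g"
      using that by (simp add: tychonoff_cube_omega1_def)
  qed
  ultimately show ?thesis
    using compact_code_space[of code] Hausdorff_code_space[of code] \<mu>(1) strictly_positive_tower_measure[OF \<mu>]
      not_countably_determined_tower_measure[OF \<mu>] continuous_map_cylinder_trace
    by (intro exI[of _ tower_space] exI[of _ \<mu>] exI[of _ cylinder_trace]) (simp only: fibre, blast)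
qed

end
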